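(* Let $(A,\mu,1_A,\alpha)$ be a Hom-algebra over a field $k$ and let $\lambda,\nu\in k$. Then the linear map $$B: A\otimes A\to A\otimes A,\qquad a\otimes b\mapsto \lambda\, ab\otimes 1_A+\nu\, 1_A\otimes ab-\nu\,\alpha(a)\otimes\alpha(b)$$ is a solution of the Hom-Yang-Baxter equation (with respect to the twist map $\alpha$ on $A$). If, in addition, $\lambda,\nu\in k^{\ast}=k\setminus\{0\}$ and $\alpha$ is involutive (i.e. $\alpha\circ\alpha=\mathrm{id}_A$), then $B$ is invertible, with inverse given by $$B^{-1}: A\otimes A\to A\otimes A,\qquad a\otimes b\mapsto \frac{1}{\nu}\, ab\otimes 1_A+\frac{1}{\lambda}\, 1_A\otimes ab-\frac{1}{\nu}\,\alpha(a)\otimes\alpha(b).$$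
   Context: Throughout, $k$ is a fixed field; vector spaces, linear maps and tensor products are over $k$. A Hom-algebra is a quadruple $(A,\mu,1_A,\alpha)$ where $A$ is a $k$-linear space, $\mu:A\otimes A\to A$ is a $k$-linear map (written $\mu(a\otimes a')=aa'$), $1_A\in A$, and $\alpha:A\to A$ is a linear endomorphism, such that for all $a,a',a''\in A$: $\alpha(aa')=\alpha(a)\alpha(a')$, $\alpha(1_A)=1_A$, $\alpha(a)(a'a'')=(aa')\alpha(a'')$, and $a1_A=1_Aa=\alpha(a)$. Hom-Yang-Baxter equation (HYBE): given a vector space $V$ and a linear endomorphism $\alpha$ of $V$, a linear map $B:V\otimes V\to V\otimes V$ is a solution of the HYBE if $B$ commutes with $\alpha\otimes\alpha$, i.e. $(\alpha\otimes\alpha)\circ B=B\circ(\alpha\otimes\alpha)$, and $$(\alpha\otimes B)\circ(B\otimes\alpha)\circ(\alpha\otimes B)=(B\otimes\alpha)\circ(\alpha\otimes B)\circ(B\otimes\alpha)$$ as maps $V\otimes V\otimes V\to V\otimes V\otimes V$. *)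

theory Defs
  imports "HOL-Algebra.AbelCoset" "Jordan_Normal_Form.Missing_VectorSpace"
begin

section \<open>Tensor products of vector spaces\<close>

text \<open>
  Vector spaces are those of the locale \<^locale>\<open>vectorspace\<close>: a carrier set with operations, over a
  field which is likewise given by a carrier set.  They are based on a record type that extends
  rings, so every such record also has \<^const>\<open>mult\<close> and \<^const>\<open>one\<close> fields.  These play no role for a
  vector space; below they are filled with zeros, and the multiplication and the unit of a
  Hom-algebra are separate parameters that are unrelated to them.
\<close>

definition free_space :: "('k, 'r) ring_scheme \<Rightarrow> 'i set \<Rightarrow> ('k, 'i \<Rightarrow> 'k) module" where
  "free_space K I =
     \<lparr>carrier = {x. x \<in> I \<rightarrow> carrier K \<and> (\<forall>i. i \<notin> I \<longrightarrow> x i = \<zero>\<^bsub>K\<^esub>) \<and> finite {i. x i \<noteq> \<zero>\<^bsub>K\<^esub>}},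
      mult = (\<lambda>x y i. \<zero>\<^bsub>K\<^esub>),
      one = (\<lambda>i. \<zero>\<^bsub>K\<^esub>),
      zero = (\<lambda>i. \<zero>\<^bsub>K\<^esub>),
      add = (\<lambda>x y i. x i \<oplus>\<^bsub>K\<^esub> y i),
      smult = (\<lambda>c x i. c \<otimes>\<^bsub>K\<^esub> x i)\<rparr>"

definition free_basis :: "('k, 'r) ring_scheme \<Rightarrow> 'i \<Rightarrow> 'i \<Rightarrow> 'k" where
  "free_basis K i = (\<lambda>j. if j = i then \<one>\<^bsub>K\<^esub> else \<zero>\<^bsub>K\<^esub>)"

text \<open>
  The elements of the quotient by a subspace \<open>H\<close> are the cosets of \<open>H\<close>.  The summand \<open>H\<close> in the scalar
  multiplication matters for the scalar zero only: it makes \<open>0 X\<close> the coset \<open>H\<close> instead of \<open>{0}\<close>.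
\<close>

definition quotient_space :: "('k, 'v, 's) module_scheme \<Rightarrow> 'v set \<Rightarrow> ('k, 'v set) module" where
  "quotient_space V H =
     \<lparr>carrier = a_rcosets\<^bsub>V\<^esub> H,
      mult = (\<lambda>X Y. H),
      one = H,
      zero = H,
      add = (\<lambda>X Y. X <+>\<^bsub>V\<^esub> Y),
      smult = (\<lambda>c X. H <+>\<^bsub>V\<^esub> ((\<lambda>x. c \<odot>\<^bsub>V\<^esub> x) ` X))\<rparr>"

definition tensor_relators ::
  "('k, 'r) ring_scheme \<Rightarrow> ('k, 'v, 's) module_scheme \<Rightarrow> ('k, 'w, 't) module_scheme
    \<Rightarrow> ('v \<times> 'w \<Rightarrow> 'k) set" where
  "tensor_relators K V W =
    (let F = free_space K (carrier V \<times> carrier W); d = (\<lambda>v w. free_basis K (v, w)) in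
       {d (v \<oplus>\<^bsub>V\<^esub> v') w \<ominus>\<^bsub>F\<^esub> (d v w \<oplus>\<^bsub>F\<^esub> d v' w) | v v' w.
          v \<in> carrier V \<and> v' \<in> carrier V \<and> w \<in> carrier W}
     \<union> {d v (w \<oplus>\<^bsub>W\<^esub> w') \<ominus>\<^bsub>F\<^esub> (d v w \<oplus>\<^bsub>F\<^esub> d v w') | v w w'.
          v \<in> carrier V \<and> w \<in> carrier W \<and> w' \<in> carrier W}
     \<union> {d (c \<odot>\<^bsub>V\<^esub> v) w \<ominus>\<^bsub>F\<^esub> c \<odot>\<^bsub>F\<^esub> d v w | c v w.
          c \<in> carrier K \<and> v \<in> carrier V \<and> w \<in> carrier W}
     \<union> {d v (c \<odot>\<^bsub>W\<^esub> w) \<ominus>\<^bsub>F\<^esub> c \<odot>\<^bsub>F\<^esub> d v w | c v w.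
          c \<in> carrier K \<and> v \<in> carrier V \<and> w \<in> carrier W})"

definition tensor_kernel ::
  "('k, 'r) ring_scheme \<Rightarrow> ('k, 'v, 's) module_scheme \<Rightarrow> ('k, 'w, 't) module_scheme
    \<Rightarrow> ('v \<times> 'w \<Rightarrow> 'k) set" where
  "tensor_kernel K V W =
     module.span K (free_space K (carrier V \<times> carrier W)) (tensor_relators K V W)"

definition tensor_space ::
  "('k, 'r) ring_scheme \<Rightarrow> ('k, 'v, 's) module_scheme \<Rightarrow> ('k, 'w, 't) module_scheme
    \<Rightarrow> ('k, ('v \<times> 'w \<Rightarrow> 'k) set) module" where
  "tensor_space K V W =
     quotient_space (free_space K (carrier V \<times> carrier W)) (tensor_kernel K V W)"

definition pure_tensor ::
  "('k, 'r) ring_scheme \<Rightarrow> ('k, 'v, 's) module_scheme \<Rightarrow> ('k, 'w, 't) module_scheme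
    \<Rightarrow> 'v \<Rightarrow> 'w \<Rightarrow> ('v \<times> 'w \<Rightarrow> 'k) set" where
  "pure_tensor K V W v w =
     tensor_kernel K V W +>\<^bsub>free_space K (carrier V \<times> carrier W)\<^esub> free_basis K (v, w)"

text \<open>
  The linear map out of a tensor product that is prescribed on pure tensors: it sends
  \<open>\<Sum>\<^sub>i c\<^sub>i (v\<^sub>i \<otimes> w\<^sub>i)\<close> to \<open>\<Sum>\<^sub>i c\<^sub>i f(v\<^sub>i, w\<^sub>i)\<close>.  If \<open>f\<close> is bilinear, the result does not depend on the
  representative \<open>x\<close> of the coset \<open>X\<close>; otherwise the value is meaningless.
\<close>

definition tensor_lift ::
  "('k, 'r) ring_scheme \<Rightarrow> ('k, 'p, 's) module_scheme \<Rightarrow> ('v \<Rightarrow> 'w \<Rightarrow> 'p)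
    \<Rightarrow> ('v \<times> 'w \<Rightarrow> 'k) set \<Rightarrow> 'p" where
  "tensor_lift K P f X =
    (let x = (SOME x. x \<in> X) in
       \<Oplus>\<^bsub>P\<^esub>i \<in> {i. x i \<noteq> \<zero>\<^bsub>K\<^esub>}. x i \<odot>\<^bsub>P\<^esub> f (fst i) (snd i))"

text \<open>
  \<open>tensor_map K V' W' f g\<close> is \<open>f \<otimes> g\<close> for linear maps \<open>f\<close> and \<open>g\<close> with codomains \<open>V'\<close> and \<open>W'\<close>.
\<close>

definition tensor_map ::
  "('k, 'r) ring_scheme \<Rightarrow> ('k, 'v2, 's) module_scheme \<Rightarrow> ('k, 'w2, 't) module_scheme
    \<Rightarrow> ('v1 \<Rightarrow> 'v2) \<Rightarrow> ('w1 \<Rightarrow> 'w2) \<Rightarrow> ('v1 \<times> 'w1 \<Rightarrow> 'k) set \<Rightarrow> ('v2 \<times> 'w2 \<Rightarrow> 'k) set" where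
  "tensor_map K V' W' f g =
     tensor_lift K (tensor_space K V' W') (\<lambda>v w. pure_tensor K V' W' (f v) (g w))"

text \<open>The canonical isomorphism \<open>(U \<otimes> V) \<otimes> W \<rightarrow> U \<otimes> (V \<otimes> W)\<close> and its inverse.\<close>

definition tensor_assoc where
  "tensor_assoc K U V W =
    (let UVW = tensor_space K U (tensor_space K V W) in
       tensor_lift K UVW
         (\<lambda>t w. tensor_lift K UVW
           (\<lambda>u v. pure_tensor K U (tensor_space K V W) u (pure_tensor K V W v w)) t))"

definition tensor_assoc_inv where
  "tensor_assoc_inv K U V W =
    (let UVW = tensor_space K (tensor_space K U V) W in
       tensor_lift K UVW
         (\<lambda>u t. tensor_lift K UVW
           (\<lambda>v w. pure_tensor K (tensor_space K U V) W (pure_tensor K U V u v) w) t))"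


section \<open>The Hom-Yang-Baxter equation\<close>

text \<open>
  The threefold tensor power is \<open>V \<otimes> (V \<otimes> V)\<close>.  Since \<open>B \<otimes> \<alpha>\<close> is a map on \<open>(V \<otimes> V) \<otimes> V\<close>, it is transported
  along the associativity isomorphism.
\<close>

definition twist_tensor_op where
  "twist_tensor_op K V \<alpha> B = tensor_map K V (tensor_space K V V) \<alpha> B"

definition op_tensor_twist where
  "op_tensor_twist K V B \<alpha> =
     tensor_assoc K V V V \<circ> tensor_map K (tensor_space K V V) V B \<alpha> \<circ> tensor_assoc_inv K V V V"

definition HYBE_solution ::
  "('k, 'r) ring_scheme \<Rightarrow> ('k, 'v, 's) module_scheme \<Rightarrow> ('v \<Rightarrow> 'v)
    \<Rightarrow> (('v \<times> 'v \<Rightarrow> 'k) set \<Rightarrow> ('v \<times> 'v \<Rightarrow> 'k) set) \<Rightarrow> bool" where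
  "HYBE_solution K V \<alpha> B \<longleftrightarrow>
     linear_map K V V \<alpha>
   \<and> linear_map K (tensor_space K V V) (tensor_space K V V) B
   \<and> (\<forall>t \<in> carrier (tensor_space K V V).
        (tensor_map K V V \<alpha> \<alpha> \<circ> B) t = (B \<circ> tensor_map K V V \<alpha> \<alpha>) t)
   \<and> (\<forall>t \<in> carrier (tensor_space K V (tensor_space K V V)).
        (twist_tensor_op K V \<alpha> B \<circ> op_tensor_twist K V B \<alpha> \<circ> twist_tensor_op K V \<alpha> B) t
      = (op_tensor_twist K V B \<alpha> \<circ> twist_tensor_op K V \<alpha> B \<circ> op_tensor_twist K V B \<alpha>) t)"


section \<open>Hom-algebras\<close>

text \<open>The multiplication \<open>\<mu>\<close> is a map on the tensor square, and this is the product \<open>a b = \<mu>(a \<otimes> b)\<close>.\<close>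

definition hom_prod ::
  "('k, 'r) ring_scheme \<Rightarrow> ('k, 'a, 's) module_scheme \<Rightarrow> (('a \<times> 'a \<Rightarrow> 'k) set \<Rightarrow> 'a)
    \<Rightarrow> 'a \<Rightarrow> 'a \<Rightarrow> 'a" where
  "hom_prod K A \<mu> a b = \<mu> (pure_tensor K A A a b)"

locale hom_algebra = vectorspace K A
  for K :: "('k, 'r) ring_scheme" and A :: "('k, 'a, 's) module_scheme" +
  fixes \<mu> :: "('a \<times> 'a \<Rightarrow> 'k) set \<Rightarrow> 'a" and u :: 'a and \<alpha> :: "'a \<Rightarrow> 'a"
  assumes linear_mult: "linear_map K (tensor_space K A A) A \<mu>"
    and unit_closed: "u \<in> carrier A"
    and linear_twist: "linear_map K A A \<alpha>"
    and twist_mult: "\<lbrakk>a \<in> carrier A; b \<in> carrier A\<rbrakk>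
      \<Longrightarrow> \<alpha> (hom_prod K A \<mu> a b) = hom_prod K A \<mu> (\<alpha> a) (\<alpha> b)"
    and twist_unit: "\<alpha> u = u"
    and hom_assoc: "\<lbrakk>a \<in> carrier A; b \<in> carrier A; c \<in> carrier A\<rbrakk>
      \<Longrightarrow> hom_prod K A \<mu> (\<alpha> a) (hom_prod K A \<mu> b c)
        = hom_prod K A \<mu> (hom_prod K A \<mu> a b) (\<alpha> c)"
    and mult_unit: "a \<in> carrier A \<Longrightarrow> hom_prod K A \<mu> a u = \<alpha> a"
    and unit_mult: "a \<in> carrier A \<Longrightarrow> hom_prod K A \<mu> u a = \<alpha> a"

end

theory Submission
  imports Defs
begin

text \<open>
  Write \<open>a'\<close> for \<open>\<alpha>(a)\<close>.  All operators in the statement are linear, and pure tensors span, so every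
  claim can be tested on pure tensors.  There \<open>B\<close> has the shape
  \<open>a \<otimes> b \<mapsto> c (ab \<otimes> 1) + d (1 \<otimes> ab) + e (a' \<otimes> b')\<close>
  with \<open>(c, d, e) = (l, n, -n)\<close>, and the candidate inverse has the same shape with
  \<open>(1/n, 1/l, -1/n)\<close>.

  For arbitrary coefficients, \<open>B\<close> commutes with \<open>\<alpha> \<otimes> \<alpha>\<close> because \<open>\<alpha>\<close> is multiplicative and fixes the
  unit (\<open>twisted_operator_commutes\<close>).

  For the braid relation, expand both sides on \<open>a \<otimes> b \<otimes> c\<close>.  Hom-associativity gives
  \<open>a'(bc) = (ab)c'\<close>; together with \<open>x1 = 1x = x'\<close> it makes the 27 summands of each side
  fall on only ten tensors: the product \<open>P = \<alpha>\<^sup>2(a)(b'c') = (a'b')\<alpha>\<^sup>2(c)\<close> in one of the three places with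
  units elsewhere, the tensors with factors \<open>\<alpha>\<^sup>3(a)\<close> and \<open>\<alpha>\<^sup>2(bc)\<close> and a unit, those with
  \<open>\<alpha>\<^sup>2(ab)\<close> and \<open>\<alpha>\<^sup>3(c)\<close> and a unit, and \<open>\<alpha>\<^sup>3(a) \<otimes> \<alpha>\<^sup>3(b) \<otimes> \<alpha>\<^sup>3(c)\<close>.  The relation then
  holds because the coefficients, polynomials in \<open>l\<close> and \<open>n\<close>, agree one by one
  (\<open>braid_combination\<close>).  Since the ten tensors may be linearly dependent and have no coefficients of
  their own, the comparison takes place in the free module on ten generators, which is then mapped
  to the tensor power.

  For the inverse, the composite maps \<open>a \<otimes> b\<close> to a combination of \<open>x = (ab)' \<otimes> 1\<close>,
  \<open>y = 1 \<otimes> (ab)'\<close> and \<open>a \<otimes> b\<close> itself: the three tensors in \<open>B(a \<otimes> b)\<close> have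
  the same product \<open>(ab)'\<close>, and \<open>\<alpha>\<^sup>2 = id\<close> returns \<open>a' \<otimes> b'\<close> to \<open>a \<otimes> b\<close>.  With the given
  scalars the coefficients of \<open>x\<close> and \<open>y\<close> vanish and that of \<open>a \<otimes> b\<close> is 1
  (\<open>inverse_cancellation\<close>).

  To reduce to pure tensors one needs the universal property of the quotient that defines the
  tensor product: \<open>tensor_lift_linear\<close>, \<open>tensor_lift_pure\<close> and the uniqueness part
  \<open>tensor_linear_ext\<close>.  The values of \<open>\<alpha> \<otimes> B\<close>, of \<open>B \<otimes> \<alpha>\<close> and of the associativity isomorphisms on
  pure tensors follow from it.
\<close>

section \<open>Linear maps\<close>

lemma linear_mapI:
  assumes V: "vectorspace K V" and W: "vectorspace K W"
    and "\<And>x. x \<in> carrier V \<Longrightarrow> f x \<in> carrier W"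
    and "\<And>x y. x \<in> carrier V \<Longrightarrow> y \<in> carrier V \<Longrightarrow> f (x \<oplus>\<^bsub>V\<^esub> y) = f x \<oplus>\<^bsub>W\<^esub> f y"
    and "\<And>c x. c \<in> carrier K \<Longrightarrow> x \<in> carrier V \<Longrightarrow> f (c \<odot>\<^bsub>V\<^esub> x) = c \<odot>\<^bsub>W\<^esub> f x"
  shows "linear_map K V W f"
proof -
  interpret V: vectorspace K V by fact
  interpret W: vectorspace K W by fact
  show ?thesis
    by unfold_locales (use assms in \<open>auto simp: module_hom_def\<close>)
qed

lemma
  assumes "linear_map K V W f"
  shows linear_map_domain: "vectorspace K V"
    and linear_map_codomain: "vectorspace K W"
    and linear_map_closed: "x \<in> carrier V \<Longrightarrow> f x \<in> carrier W"
    and linear_map_add: "\<lbrakk>x \<in> carrier V; y \<in> carrier V\<rbrakk> \<Longrightarrow> f (x \<oplus>\<^bsub>V\<^esub> y) = f x \<oplus>\<^bsub>W\<^esub> f y"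
    and linear_map_smult: "\<lbrakk>c \<in> carrier K; x \<in> carrier V\<rbrakk> \<Longrightarrow> f (c \<odot>\<^bsub>V\<^esub> x) = c \<odot>\<^bsub>W\<^esub> f x"
proof -
  interpret linear_map K V W f by fact
  show "vectorspace K V" "vectorspace K W" by unfold_locales
  show "x \<in> carrier V \<Longrightarrow> f x \<in> carrier W" by simp
  show "\<lbrakk>x \<in> carrier V; y \<in> carrier V\<rbrakk> \<Longrightarrow> f (x \<oplus>\<^bsub>V\<^esub> y) = f x \<oplus>\<^bsub>W\<^esub> f y" by simp
  show "\<lbrakk>c \<in> carrier K; x \<in> carrier V\<rbrakk> \<Longrightarrow> f (c \<odot>\<^bsub>V\<^esub> x) = c \<odot>\<^bsub>W\<^esub> f x" by simp
qed

lemma linear_map_compose: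
  assumes f: "linear_map K U V f" and g: "linear_map K V W g"
  shows "linear_map K U W (\<lambda>x. g (f x))"
  using assms
  by (auto intro!: linear_mapI[OF linear_map_domain[OF f] linear_map_codomain[OF g]]
      simp: linear_map_closed linear_map_add linear_map_smult)

lemma linear_map_cong:
  assumes f: "linear_map K V W f" and eq: "\<And>x. x \<in> carrier V \<Longrightarrow> g x = f x"
  shows "linear_map K V W g"
proof -
  interpret V: vectorspace K V using f by (rule linear_map_domain)
  show ?thesis
    by (rule linear_mapI[OF linear_map_domain[OF f] linear_map_codomain[OF f]])
      (simp_all add: eq linear_map_closed[OF f] linear_map_add[OF f] linear_map_smult[OF f])
qed

lemma linear_map_ident: "vectorspace K V \<Longrightarrow> linear_map K V V (\<lambda>x. x)"
  by (intro linear_mapI) auto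

text \<open>
  The three-term shape shared by \<open>B\<close> and its inverse.  Keeping it folded lets linear maps pass through
  it in one step, so that iterated operators appear as nested combinations of tensors.
\<close>

definition lincomb3 :: "('k, 'v, 's) module_scheme \<Rightarrow> 'k \<Rightarrow> 'k \<Rightarrow> 'k \<Rightarrow> 'v \<Rightarrow> 'v \<Rightarrow> 'v \<Rightarrow> 'v" where
  "lincomb3 V c d e x y z = c \<odot>\<^bsub>V\<^esub> x \<oplus>\<^bsub>V\<^esub> d \<odot>\<^bsub>V\<^esub> y \<oplus>\<^bsub>V\<^esub> e \<odot>\<^bsub>V\<^esub> z"

lemma (in module) lincomb3_closed [simp, intro]:
  "\<lbrakk>c \<in> carrier R; d \<in> carrier R; e \<in> carrier R; x \<in> carrier M; y \<in> carrier M; z \<in> carrier M\<rbrakk>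
    \<Longrightarrow> lincomb3 M c d e x y z \<in> carrier M"
  by (simp add: lincomb3_def)

lemma linear_map_lincomb3:
  assumes f: "linear_map K V W f"
    and cde: "c \<in> carrier K" "d \<in> carrier K" "e \<in> carrier K"
    and xyz: "x \<in> carrier V" "y \<in> carrier V" "z \<in> carrier V"
  shows "f (lincomb3 V c d e x y z) = lincomb3 W c d e (f x) (f y) (f z)"
proof -
  interpret linear_map K V W f by fact
  show ?thesis using cde xyz by (simp add: lincomb3_def)
qed

lemma linear_map_sum:
  assumes f: "linear_map K V W f" and g: "linear_map K V W g"
  shows "linear_map K V W (\<lambda>x. f x \<oplus>\<^bsub>W\<^esub> g x)"
proof -
  interpret V: vectorspace K V using f by (rule linear_map_domain)
  interpret W: vectorspace K W using f by (rule linear_map_codomain)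
  interpret F: linear_map K V W f by fact
  interpret G: linear_map K V W g by fact
  show ?thesis
    by (rule linear_mapI) (unfold_locales, simp_all add: W.smult_r_distr W.a_ac)
qed

lemma linear_map_scale:
  assumes f: "linear_map K V W f" and c: "c \<in> carrier K"
  shows "linear_map K V W (\<lambda>x. c \<odot>\<^bsub>W\<^esub> f x)"
proof -
  interpret V: vectorspace K V using f by (rule linear_map_domain)
  interpret W: vectorspace K W using f by (rule linear_map_codomain)
  interpret F: linear_map K V W f by fact
  show ?thesis
    by (rule linear_mapI)
      (unfold_locales, simp_all add: c W.smult_r_distr W.smult_assoc1[symmetric] V.m_comm)
qed

lemma linear_map_combination:
  assumes "linear_map K V W f" "linear_map K V W g" "linear_map K V W h"
    and "c \<in> carrier K" "d \<in> carrier K" "e \<in> carrier K"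
  shows "linear_map K V W (\<lambda>x. lincomb3 W c d e (f x) (g x) (h x))"
  unfolding lincomb3_def using assms by (intro linear_map_sum linear_map_scale)

section \<open>Free vector spaces\<close>

lemma free_space_simps [simp]:
  "\<zero>\<^bsub>free_space K I\<^esub> = (\<lambda>i. \<zero>\<^bsub>K\<^esub>)"
  "x \<oplus>\<^bsub>free_space K I\<^esub> y = (\<lambda>i. x i \<oplus>\<^bsub>K\<^esub> y i)"
  "c \<odot>\<^bsub>free_space K I\<^esub> x = (\<lambda>i. c \<otimes>\<^bsub>K\<^esub> x i)"
  by (simp_all add: free_space_def)

lemma free_space_carrier:
  "x \<in> carrier (free_space K I) \<longleftrightarrow>
     (\<forall>i\<in>I. x i \<in> carrier K) \<and> (\<forall>i. i \<notin> I \<longrightarrow> x i = \<zero>\<^bsub>K\<^esub>) \<and> finite {i. x i \<noteq> \<zero>\<^bsub>K\<^esub>}"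
  by (auto simp: free_space_def)

context field
begin

lemma free_space_coeff: "x \<in> carrier (free_space R I) \<Longrightarrow> x i \<in> carrier R"
  by (cases "i \<in> I") (auto simp: free_space_carrier)

lemma free_basis_closed: "i \<in> I \<Longrightarrow> free_basis R i \<in> carrier (free_space R I)"
  by (auto simp: free_space_carrier free_basis_def)

lemma free_space_vectorspace: "vectorspace R (free_space R I)"
proof (rule vs_criteria, unfold free_space_simps)
  let ?F = "carrier (free_space R I)"
  show "field R" by unfold_locales
  show "(\<lambda>i. \<zero>) \<in> ?F" by (simp add: free_space_carrier)
  show "\<forall>v w. v \<in> ?F \<and> w \<in> ?F \<longrightarrow> (\<lambda>i. v i \<oplus> w i) \<in> ?F"
  proof (intro allI impI, elim conjE)
    fix v w assume vw: "v \<in> ?F" "w \<in> ?F"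
    have "{i. v i \<oplus> w i \<noteq> \<zero>} \<subseteq> {i. v i \<noteq> \<zero>} \<union> {i. w i \<noteq> \<zero>}" by auto
    then show "(\<lambda>i. v i \<oplus> w i) \<in> ?F"
      using vw by (auto simp: free_space_carrier intro: finite_subset)
  qed
  show "\<forall>v\<in>?F. \<exists>w\<in>?F. (\<lambda>i. v i \<oplus> w i) = (\<lambda>i. \<zero>)"
  proof
    fix v assume v: "v \<in> ?F"
    have "{i. \<ominus> v i \<noteq> \<zero>} \<subseteq> {i. v i \<noteq> \<zero>}" by auto
    then have "(\<lambda>i. \<ominus> v i) \<in> ?F"
      using v by (auto simp: free_space_carrier intro: finite_subset)
    moreover have "(\<lambda>i. v i \<oplus> \<ominus> v i) = (\<lambda>i. \<zero>)"
      using v by (simp add: r_neg free_space_coeff)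
    ultimately show "\<exists>w\<in>?F. (\<lambda>i. v i \<oplus> w i) = (\<lambda>i. \<zero>)" by (intro bexI[of _ "\<lambda>i. \<ominus> v i"])
  qed
  show "\<forall>c v. c \<in> carrier R \<and> v \<in> ?F \<longrightarrow> (\<lambda>i. c \<otimes> v i) \<in> ?F"
  proof (intro allI impI, elim conjE)
    fix c v assume cv: "c \<in> carrier R" "v \<in> ?F"
    have "{i. c \<otimes> v i \<noteq> \<zero>} \<subseteq> {i. v i \<noteq> \<zero>}" using cv(1) by auto
    then show "(\<lambda>i. c \<otimes> v i) \<in> ?F"
      using cv by (auto simp: free_space_carrier intro: finite_subset)
  qed
qed (auto simp: free_space_coeff a_ac m_assoc l_distr r_distr)

text \<open>
  The basis vectors span: a vector of finite support is reached by adding one basis vector at a time.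
\<close>

lemma free_linear_ext:
  assumes f: "linear_map R (free_space R I) P f" and g: "linear_map R (free_space R I) P g"
    and eq: "\<And>i. i \<in> I \<Longrightarrow> f (free_basis R i) = g (free_basis R i)"
    and x: "x \<in> carrier (free_space R I)"
  shows "f x = g x"
proof -
  interpret free: vectorspace R "free_space R I" by (rule free_space_vectorspace)
  interpret F: linear_map R "free_space R I" P f by fact
  interpret G: linear_map R "free_space R I" P g by fact
  have "f x = g x" if "finite S" "{i. x i \<noteq> \<zero>} \<subseteq> S" "x \<in> carrier (free_space R I)" for S x
    using that
  proof (induction S arbitrary: x rule: finite_induct)
    case empty
    then have "x = \<zero>\<^bsub>free_space R I\<^esub>" by auto
    then show ?case using F.T0_is_0 G.T0_is_0 by metis
  next
    case (insert j S)
    show ?case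
    proof (cases "x j = \<zero>")
      case True
      with insert show ?thesis by blast
    next
      case False
      with insert.prems have j: "j \<in> I" by (auto simp: free_space_carrier)
      define y where "y = x(j := \<zero>)"
      have "{i. y i \<noteq> \<zero>} \<subseteq> {i. x i \<noteq> \<zero>}" by (auto simp: y_def)
      then have y: "y \<in> carrier (free_space R I)"
        using insert.prems by (auto simp: free_space_carrier y_def intro: finite_subset)
      have yS: "{i. y i \<noteq> \<zero>} \<subseteq> S" using insert.prems by (auto simp: y_def)
      have xj: "x j \<in> carrier R" using insert.prems by (simp add: free_space_coeff)
      have x: "x = y \<oplus>\<^bsub>free_space R I\<^esub> x j \<odot>\<^bsub>free_space R I\<^esub> free_basis R j"
        using insert.prems xj
        by (auto simp: y_def free_basis_def free_space_coeff)
      note cl = y xj free_basis_closed[OF j] free.smult_closed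
      have "f x = f y \<oplus>\<^bsub>P\<^esub> x j \<odot>\<^bsub>P\<^esub> f (free_basis R j)"
        by (subst x) (use cl in \<open>simp only: F.T_add F.T_smult\<close>)
      also have "\<dots> = g y \<oplus>\<^bsub>P\<^esub> x j \<odot>\<^bsub>P\<^esub> g (free_basis R j)"
        using insert.IH[OF yS y] eq[OF j] by simp
      also have "\<dots> = g x"
        by (rule sym, subst x) (use cl in \<open>simp only: G.T_add G.T_smult\<close>)
      finally show ?thesis .
    qed
  qed
  with x show ?thesis by (auto simp: free_space_carrier)
qed

end

text \<open>
  The linear extension of a map on the basis; \<^const>\<open>tensor_lift\<close> evaluates it at a representative of
  the coset.
\<close>

definition free_lift :: "('k, 'r) ring_scheme \<Rightarrow> ('k, 'p, 's) module_scheme \<Rightarrow> ('i \<Rightarrow> 'p) \<Rightarrow> ('i \<Rightarrow> 'k) \<Rightarrow> 'p" where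
  "free_lift K P f x = (\<Oplus>\<^bsub>P\<^esub>i \<in> {i. x i \<noteq> \<zero>\<^bsub>K\<^esub>}. x i \<odot>\<^bsub>P\<^esub> f i)"

context vectorspace
begin

text \<open>
  Padding the support allows two vectors to be summed over the same index set.
\<close>

lemma free_lift_superset:
  assumes f: "f \<in> I \<rightarrow> carrier V" and x: "x \<in> carrier (free_space K I)"
    and S: "finite S" "S \<subseteq> I" "{i. x i \<noteq> \<zero>\<^bsub>K\<^esub>} \<subseteq> S"
  shows "free_lift K V f x = (\<Oplus>\<^bsub>V\<^esub>i\<in>S. x i \<odot>\<^bsub>V\<^esub> f i)"
  unfolding free_lift_def
  using S f x
  by (intro module.M.add.finprod_mono_neutral_cong_left)
    (auto simp: free_space_coeff subset_eq Pi_iff)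

lemma free_lift_linear:
  assumes f: "f \<in> I \<rightarrow> carrier V"
  shows "linear_map K (free_space K I) V (free_lift K V f)"
proof (rule linear_mapI)
  let ?F = "free_space K I"
  interpret F: vectorspace K ?F by (rule free_space_vectorspace)
  show "vectorspace K ?F" "vectorspace K V" by unfold_locales
  have supp: "finite {i. x i \<noteq> \<zero>\<^bsub>K\<^esub>}" "{i. x i \<noteq> \<zero>\<^bsub>K\<^esub>} \<subseteq> I" if "x \<in> carrier ?F" for x
    using that by (auto simp: free_space_carrier)
  fix x assume x: "x \<in> carrier ?F"
  show "free_lift K V f x \<in> carrier V"
    unfolding free_lift_def
    using f x supp[OF x] by (intro finsum_closed) (auto simp: free_space_coeff Pi_iff subset_eq)
  show "free_lift K V f (c \<odot>\<^bsub>?F\<^esub> x) = c \<odot>\<^bsub>V\<^esub> free_lift K V f x" if c: "c \<in> carrier K" for c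
  proof -
    let ?S = "{i. x i \<noteq> \<zero>\<^bsub>K\<^esub>}"
    have "free_lift K V f (c \<odot>\<^bsub>?F\<^esub> x) = (\<Oplus>\<^bsub>V\<^esub>i\<in>?S. (c \<odot>\<^bsub>?F\<^esub> x) i \<odot>\<^bsub>V\<^esub> f i)"
      using c x supp[OF x] by (intro free_lift_superset[OF f] F.smult_closed) auto
    also have "\<dots> = (\<Oplus>\<^bsub>V\<^esub>i\<in>?S. c \<odot>\<^bsub>V\<^esub> (x i \<odot>\<^bsub>V\<^esub> f i))"
      using c x supp[OF x] f by (intro finsum_cong') (auto simp: smult_assoc1 free_space_coeff Pi_iff subset_eq)
    also have "\<dots> = c \<odot>\<^bsub>V\<^esub> free_lift K V f x"
      unfolding free_lift_def
      using c x supp[OF x] f by (intro finsum_smult[symmetric]) (auto simp: free_space_coeff Pi_iff subset_eq)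
    finally show ?thesis .
  qed
  fix y assume y: "y \<in> carrier ?F"
  let ?S = "{i. x i \<noteq> \<zero>\<^bsub>K\<^esub>} \<union> {i. y i \<noteq> \<zero>\<^bsub>K\<^esub>}"
  have "free_lift K V f (x \<oplus>\<^bsub>?F\<^esub> y) = (\<Oplus>\<^bsub>V\<^esub>i\<in>?S. (x \<oplus>\<^bsub>?F\<^esub> y) i \<odot>\<^bsub>V\<^esub> f i)"
    using x y supp[OF x] supp[OF y] by (intro free_lift_superset[OF f] F.a_closed) auto
  also have "\<dots> = (\<Oplus>\<^bsub>V\<^esub>i\<in>?S. x i \<odot>\<^bsub>V\<^esub> f i \<oplus>\<^bsub>V\<^esub> y i \<odot>\<^bsub>V\<^esub> f i)"
    using x y supp[OF x] supp[OF y] f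
    by (intro finsum_cong') (auto simp: smult_l_distr free_space_coeff Pi_iff)
  also have "\<dots> = (\<Oplus>\<^bsub>V\<^esub>i\<in>?S. x i \<odot>\<^bsub>V\<^esub> f i) \<oplus>\<^bsub>V\<^esub> (\<Oplus>\<^bsub>V\<^esub>i\<in>?S. y i \<odot>\<^bsub>V\<^esub> f i)"
    using x y supp[OF x] supp[OF y] f
    by (intro finsum_addf) (auto simp: free_space_coeff Pi_iff)
  also have "\<dots> = free_lift K V f x \<oplus>\<^bsub>V\<^esub> free_lift K V f y"
    using x y supp[OF x] supp[OF y] by (simp add: free_lift_superset[OF f, of _ ?S])
  finally show "free_lift K V f (x \<oplus>\<^bsub>?F\<^esub> y) = free_lift K V f x \<oplus>\<^bsub>V\<^esub> free_lift K V f y" .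
qed

lemma free_lift_basis:
  assumes "f i \<in> carrier V"
  shows "free_lift K V f (free_basis K i) = f i"
proof -
  have "{j. free_basis K i j \<noteq> \<zero>\<^bsub>K\<^esub>} = {i}" by (auto simp: free_basis_def)
  then show ?thesis using assms by (simp add: free_lift_def free_basis_def)
qed

end

section \<open>Quotient spaces\<close>

lemma quotient_space_simps [simp]:
  "carrier (quotient_space V H) = a_rcosets\<^bsub>V\<^esub> H"
  "\<zero>\<^bsub>quotient_space V H\<^esub> = H"
  "X \<oplus>\<^bsub>quotient_space V H\<^esub> Y = X <+>\<^bsub>V\<^esub> Y"
  "c \<odot>\<^bsub>quotient_space V H\<^esub> X = H <+>\<^bsub>V\<^esub> ((\<lambda>x. c \<odot>\<^bsub>V\<^esub> x) ` X)"
  by (simp_all add: quotient_space_def)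

lemma submodule_abelian_subgroup:
  assumes "submodule K H V"
  shows "abelian_subgroup H V"
proof -
  interpret submodule K H V by fact
  interpret V: module K V by (rule module)
  show ?thesis
  proof (rule abelian_subgroupI3)
    show "additive_subgroup H V"
    proof (rule additive_subgroupI, rule V.add.subgroupI)
      show "\<ominus>\<^bsub>V\<^esub> x \<in> H" if x: "x \<in> H" for x
      proof -
        have "(\<ominus>\<^bsub>K\<^esub> \<one>\<^bsub>K\<^esub>) \<odot>\<^bsub>V\<^esub> x = \<ominus>\<^bsub>V\<^esub> x" using x subset by (intro V.smult_minus_1) blast
        moreover have "(\<ominus>\<^bsub>K\<^esub> \<one>\<^bsub>K\<^esub>) \<odot>\<^bsub>V\<^esub> x \<in> H" using x by (intro smult_closed) auto
        ultimately show ?thesis by simp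
      qed
      show "H \<noteq> {}" using zero_closed by blast
    qed (use subset in auto)
  qed unfold_locales
qed

context
  fixes K :: "('k, 'r) ring_scheme" and V :: "('k, 'v, 's) module_scheme" and H
  assumes V: "vectorspace K V" and H: "submodule K H V"
begin

text \<open>
  The summand \<open>H\<close> in the scalar multiplication restores a full coset when \<open>c = 0\<close>; for every other \<open>c\<close>
  it is absorbed.
\<close>

lemma smult_coset:
  assumes c: "c \<in> carrier K" and x: "x \<in> carrier V"
  shows "H <+>\<^bsub>V\<^esub> ((\<lambda>x. c \<odot>\<^bsub>V\<^esub> x) ` (H +>\<^bsub>V\<^esub> x)) = H +>\<^bsub>V\<^esub> (c \<odot>\<^bsub>V\<^esub> x)"
proof
  interpret V: vectorspace K V by (rule V)
  interpret H: submodule K H V by (rule H)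
  have Hc: "h \<in> carrier V" if "h \<in> H" for h using that H.subset by blast
  show "H <+>\<^bsub>V\<^esub> ((\<lambda>x. c \<odot>\<^bsub>V\<^esub> x) ` (H +>\<^bsub>V\<^esub> x)) \<subseteq> H +>\<^bsub>V\<^esub> (c \<odot>\<^bsub>V\<^esub> x)"
  proof
    fix z assume "z \<in> H <+>\<^bsub>V\<^esub> ((\<lambda>x. c \<odot>\<^bsub>V\<^esub> x) ` (H +>\<^bsub>V\<^esub> x))"
    then obtain h h' where hh: "h \<in> H" "h' \<in> H" "z = h \<oplus>\<^bsub>V\<^esub> c \<odot>\<^bsub>V\<^esub> (h' \<oplus>\<^bsub>V\<^esub> x)"
      by (auto simp: set_add_def' a_r_coset_def')
    then have "z = (h \<oplus>\<^bsub>V\<^esub> c \<odot>\<^bsub>V\<^esub> h') \<oplus>\<^bsub>V\<^esub> c \<odot>\<^bsub>V\<^esub> x"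
      using c x by (simp add: Hc V.smult_r_distr V.a_assoc)
    moreover have "h \<oplus>\<^bsub>V\<^esub> c \<odot>\<^bsub>V\<^esub> h' \<in> H" using hh c by blast
    ultimately show "z \<in> H +>\<^bsub>V\<^esub> (c \<odot>\<^bsub>V\<^esub> x)" by (auto simp: a_r_coset_def')
  qed
  show "H +>\<^bsub>V\<^esub> (c \<odot>\<^bsub>V\<^esub> x) \<subseteq> H <+>\<^bsub>V\<^esub> ((\<lambda>x. c \<odot>\<^bsub>V\<^esub> x) ` (H +>\<^bsub>V\<^esub> x))"
  proof
    fix z assume "z \<in> H +>\<^bsub>V\<^esub> (c \<odot>\<^bsub>V\<^esub> x)"
    then obtain h where h: "h \<in> H" "z = h \<oplus>\<^bsub>V\<^esub> c \<odot>\<^bsub>V\<^esub> x" by (auto simp: a_r_coset_def')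
    have "x \<in> H +>\<^bsub>V\<^esub> x" by (rule abelian_subgroup.a_rcos_self[OF submodule_abelian_subgroup[OF H] x])
    with h show "z \<in> H <+>\<^bsub>V\<^esub> ((\<lambda>x. c \<odot>\<^bsub>V\<^esub> x) ` (H +>\<^bsub>V\<^esub> x))"
      by (auto simp: set_add_def')
  qed
qed

lemma quotient_space_vectorspace: "vectorspace K (quotient_space V H)"
proof -
  interpret V: vectorspace K V by (rule V)
  interpret H: submodule K H V by (rule H)
  interpret A: abelian_subgroup H V using H by (rule submodule_abelian_subgroup)
  have coset: "\<exists>x\<in>carrier V. X = H +>\<^bsub>V\<^esub> x" if "X \<in> a_rcosets\<^bsub>V\<^esub> H" for X
    using that by (auto simp: A_RCOSETS_def')
  have closed: "H +>\<^bsub>V\<^esub> x \<in> a_rcosets\<^bsub>V\<^esub> H" if "x \<in> carrier V" for x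
    using that by (auto simp: A_RCOSETS_def')
  have H0: "H = H +>\<^bsub>V\<^esub> \<zero>\<^bsub>V\<^esub>" using H.subset by simp
  note ops = A.a_rcos_sum smult_coset closed V.a_ac V.smult_l_distr V.smult_r_distr V.smult_assoc1
  show ?thesis
  proof (rule vs_criteria, unfold quotient_space_simps)
    show "field K" by unfold_locales
    show "H \<in> a_rcosets\<^bsub>V\<^esub> H" by (subst (1) H0) (rule closed, simp)
    show "\<forall>X\<in>a_rcosets\<^bsub>V\<^esub> H. \<exists>Y\<in>a_rcosets\<^bsub>V\<^esub> H. X <+>\<^bsub>V\<^esub> Y = H"
    proof
      fix X assume "X \<in> a_rcosets\<^bsub>V\<^esub> H"
      then obtain x where x: "x \<in> carrier V" "X = H +>\<^bsub>V\<^esub> x" using coset by blast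
      then have "X <+>\<^bsub>V\<^esub> (H +>\<^bsub>V\<^esub> (\<ominus>\<^bsub>V\<^esub> x)) = H" by (simp add: ops V.r_neg H0[symmetric])
      moreover have "H +>\<^bsub>V\<^esub> (\<ominus>\<^bsub>V\<^esub> x) \<in> a_rcosets\<^bsub>V\<^esub> H" using x by (simp add: closed)
      ultimately show "\<exists>Y\<in>a_rcosets\<^bsub>V\<^esub> H. X <+>\<^bsub>V\<^esub> Y = H" by blast
    qed
    show "\<forall>X\<in>a_rcosets\<^bsub>V\<^esub> H. X <+>\<^bsub>V\<^esub> H = X"
      using coset A.a_rcos_sum H0 V.zero_closed V.r_zero by metis
  qed ((intro allI impI ballI; (elim conjE)?; (drule coset)+; clarsimp simp: ops)+)
qed

lemma coset_map_linear: "linear_map K V (quotient_space V H) (\<lambda>x. H +>\<^bsub>V\<^esub> x)"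
proof (rule linear_mapI[OF V quotient_space_vectorspace], unfold quotient_space_simps)
  interpret V: vectorspace K V by (rule V)
  interpret A: abelian_subgroup H V using H by (rule submodule_abelian_subgroup)
  show "H +>\<^bsub>V\<^esub> x \<in> a_rcosets\<^bsub>V\<^esub> H" if "x \<in> carrier V" for x
    using that by (auto simp: A_RCOSETS_def')
  show "H +>\<^bsub>V\<^esub> (x \<oplus>\<^bsub>V\<^esub> y) = (H +>\<^bsub>V\<^esub> x) <+>\<^bsub>V\<^esub> (H +>\<^bsub>V\<^esub> y)" if "x \<in> carrier V" "y \<in> carrier V" for x y
    using that by (simp add: A.a_rcos_sum)
qed (simp add: smult_coset)

end

section \<open>The universal property of the tensor product\<close>

text \<open>
  Bilinearity is phrased by linearity of the partial maps, so that the lemmas on composites and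
  combinations of linear maps apply to each argument.
\<close>

definition bilinear_map ::
  "('k, 'r) ring_scheme \<Rightarrow> ('k, 'v, 's) module_scheme \<Rightarrow> ('k, 'w, 't) module_scheme
    \<Rightarrow> ('k, 'p, 'q) module_scheme \<Rightarrow> ('v \<Rightarrow> 'w \<Rightarrow> 'p) \<Rightarrow> bool" where
  "bilinear_map K V W P f \<longleftrightarrow>
     (\<forall>v\<in>carrier V. linear_map K W P (f v)) \<and> (\<forall>w\<in>carrier W. linear_map K V P (\<lambda>v. f v w))"

lemma bilinear_mapI:
  assumes "\<And>v. v \<in> carrier V \<Longrightarrow> linear_map K W P (f v)"
    and "\<And>w. w \<in> carrier W \<Longrightarrow> linear_map K V P (\<lambda>v. f v w)"
  shows "bilinear_map K V W P f"
  using assms by (simp add: bilinear_map_def)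

lemma bilinear_map_right: "\<lbrakk>bilinear_map K V W P f; v \<in> carrier V\<rbrakk> \<Longrightarrow> linear_map K W P (f v)"
  by (simp add: bilinear_map_def)

lemma bilinear_map_left: "\<lbrakk>bilinear_map K V W P f; w \<in> carrier W\<rbrakk> \<Longrightarrow> linear_map K V P (\<lambda>v. f v w)"
  by (simp add: bilinear_map_def)

context
  fixes K :: "('k, 'r) ring_scheme" and V :: "('k, 'v, 's) module_scheme"
    and W :: "('k, 'w, 't) module_scheme"
  assumes V: "vectorspace K V" and W: "vectorspace K W"
begin

private abbreviation (input) F where "F \<equiv> free_space K (carrier V \<times> carrier W)"

lemma free_pairs_vectorspace: "vectorspace K F"
proof -
  interpret V: vectorspace K V by (rule V)
  show ?thesis by (rule V.free_space_vectorspace)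
qed

lemma free_pairs_basis:
  "\<lbrakk>v \<in> carrier V; w \<in> carrier W\<rbrakk> \<Longrightarrow> free_basis K (v, w) \<in> carrier F"
proof -
  interpret V: vectorspace K V by (rule V)
  show "\<lbrakk>v \<in> carrier V; w \<in> carrier W\<rbrakk> \<Longrightarrow> ?thesis" by (simp add: V.free_basis_closed)
qed

lemma tensor_relators_subset: "tensor_relators K V W \<subseteq> carrier F"
proof -
  interpret V: vectorspace K V by (rule V)
  interpret W: vectorspace K W by (rule W)
  interpret F: vectorspace K F by (rule free_pairs_vectorspace)
  show ?thesis
    unfolding tensor_relators_def Let_def
    by (intro Un_least subsetI; clarify)
      (intro F.minus_closed F.a_closed F.smult_closed free_pairs_basis V.a_closed W.a_closed
        V.smult_closed W.smult_closed; assumption)+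
qed

lemma tensor_kernel_submodule: "submodule K (tensor_kernel K V W) F"
proof -
  interpret F: vectorspace K F by (rule free_pairs_vectorspace)
  show ?thesis
    unfolding tensor_kernel_def by (rule F.span_is_submodule[OF tensor_relators_subset])
qed

lemma relator_in_tensor_kernel: "x \<in> tensor_relators K V W \<Longrightarrow> x \<in> tensor_kernel K V W"
proof -
  interpret F: vectorspace K F by (rule free_pairs_vectorspace)
  show "x \<in> tensor_relators K V W \<Longrightarrow> ?thesis"
    unfolding tensor_kernel_def using F.in_own_span[OF tensor_relators_subset] by blast
qed

lemma tensor_space_vectorspace: "vectorspace K (tensor_space K V W)"
  unfolding tensor_space_def
  by (rule quotient_space_vectorspace[OF free_pairs_vectorspace tensor_kernel_submodule])

lemma tensor_coset_linear:
  "linear_map K F (tensor_space K V W) (\<lambda>x. tensor_kernel K V W +>\<^bsub>F\<^esub> x)"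
  unfolding tensor_space_def
  by (rule coset_map_linear[OF free_pairs_vectorspace tensor_kernel_submodule])

lemma tensor_coset_eqI:
  assumes xy: "x \<in> carrier F" "y \<in> carrier F" and "x \<ominus>\<^bsub>F\<^esub> y \<in> tensor_kernel K V W"
  shows "tensor_kernel K V W +>\<^bsub>F\<^esub> x = tensor_kernel K V W +>\<^bsub>F\<^esub> y"
proof -
  interpret A: abelian_subgroup "tensor_kernel K V W" F
    by (rule submodule_abelian_subgroup[OF tensor_kernel_submodule])
  have "x \<in> tensor_kernel K V W +>\<^bsub>F\<^esub> y"
    using assms by (intro A.a_rcos_module_rev) (simp_all add: a_minus_def)
  with xy show ?thesis using A.a_repr_independence' by blast
qed

text \<open>
  Each of the four laws is one of the four families of relators.
\<close>

lemma pure_tensor_bilinear: "bilinear_map K V W (tensor_space K V W) (pure_tensor K V W)"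
proof -
  interpret V: vectorspace K V by (rule V)
  interpret W: vectorspace K W by (rule W)
  interpret F: vectorspace K F by (rule free_pairs_vectorspace)
  let ?T = "tensor_space K V W" and ?k = "\<lambda>x. tensor_kernel K V W +>\<^bsub>F\<^esub> x"
  let ?d = "\<lambda>v w. free_basis K (v, w)"
  note cl = free_pairs_basis F.a_closed F.smult_closed V.a_closed W.a_closed V.smult_closed W.smult_closed
  have d: "?k (?d v w) \<in> carrier ?T" if "v \<in> carrier V" "w \<in> carrier W" for v w
    using that by (intro linear_map_closed[OF tensor_coset_linear] free_pairs_basis)
  show ?thesis
  proof (intro bilinear_mapI linear_mapI V W tensor_space_vectorspace; unfold pure_tensor_def)
    fix v w w' assume a: "v \<in> carrier V" "w \<in> carrier W" "w' \<in> carrier W"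
    have "?d v (w \<oplus>\<^bsub>W\<^esub> w') \<ominus>\<^bsub>F\<^esub> (?d v w \<oplus>\<^bsub>F\<^esub> ?d v w') \<in> tensor_kernel K V W"
      using a by (intro relator_in_tensor_kernel) (unfold tensor_relators_def Let_def, blast)
    then have "?k (?d v (w \<oplus>\<^bsub>W\<^esub> w')) = ?k (?d v w \<oplus>\<^bsub>F\<^esub> ?d v w')"
      using a by (intro tensor_coset_eqI cl)
    also have "\<dots> = ?k (?d v w) \<oplus>\<^bsub>?T\<^esub> ?k (?d v w')"
      using a by (intro linear_map_add[OF tensor_coset_linear] cl)
    finally show "?k (?d v (w \<oplus>\<^bsub>W\<^esub> w')) = ?k (?d v w) \<oplus>\<^bsub>?T\<^esub> ?k (?d v w')" .
  next
    fix v c w assume a: "v \<in> carrier V" "c \<in> carrier K" "w \<in> carrier W"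
    have "?d v (c \<odot>\<^bsub>W\<^esub> w) \<ominus>\<^bsub>F\<^esub> c \<odot>\<^bsub>F\<^esub> ?d v w \<in> tensor_kernel K V W"
      using a by (intro relator_in_tensor_kernel) (unfold tensor_relators_def Let_def, blast)
    then have "?k (?d v (c \<odot>\<^bsub>W\<^esub> w)) = ?k (c \<odot>\<^bsub>F\<^esub> ?d v w)"
      using a by (intro tensor_coset_eqI cl)
    also have "\<dots> = c \<odot>\<^bsub>?T\<^esub> ?k (?d v w)"
      using a by (intro linear_map_smult[OF tensor_coset_linear] cl)
    finally show "?k (?d v (c \<odot>\<^bsub>W\<^esub> w)) = c \<odot>\<^bsub>?T\<^esub> ?k (?d v w)" .
  next
    fix w v v' assume a: "w \<in> carrier W" "v \<in> carrier V" "v' \<in> carrier V"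
    have "?d (v \<oplus>\<^bsub>V\<^esub> v') w \<ominus>\<^bsub>F\<^esub> (?d v w \<oplus>\<^bsub>F\<^esub> ?d v' w) \<in> tensor_kernel K V W"
      using a by (intro relator_in_tensor_kernel) (unfold tensor_relators_def Let_def, blast)
    then have "?k (?d (v \<oplus>\<^bsub>V\<^esub> v') w) = ?k (?d v w \<oplus>\<^bsub>F\<^esub> ?d v' w)"
      using a by (intro tensor_coset_eqI cl)
    also have "\<dots> = ?k (?d v w) \<oplus>\<^bsub>?T\<^esub> ?k (?d v' w)"
      using a by (intro linear_map_add[OF tensor_coset_linear] cl)
    finally show "?k (?d (v \<oplus>\<^bsub>V\<^esub> v') w) = ?k (?d v w) \<oplus>\<^bsub>?T\<^esub> ?k (?d v' w)" .
  next
    fix w c v assume a: "w \<in> carrier W" "c \<in> carrier K" "v \<in> carrier V"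
    have "?d (c \<odot>\<^bsub>V\<^esub> v) w \<ominus>\<^bsub>F\<^esub> c \<odot>\<^bsub>F\<^esub> ?d v w \<in> tensor_kernel K V W"
      using a by (intro relator_in_tensor_kernel) (unfold tensor_relators_def Let_def, blast)
    then have "?k (?d (c \<odot>\<^bsub>V\<^esub> v) w) = ?k (c \<odot>\<^bsub>F\<^esub> ?d v w)"
      using a by (intro tensor_coset_eqI cl)
    also have "\<dots> = c \<odot>\<^bsub>?T\<^esub> ?k (?d v w)"
      using a by (intro linear_map_smult[OF tensor_coset_linear] cl)
    finally show "?k (?d (c \<odot>\<^bsub>V\<^esub> v) w) = c \<odot>\<^bsub>?T\<^esub> ?k (?d v w)" .
  qed (use d in auto)
qed

text \<open>
  Uniqueness: pulled back along the projection, both maps are linear on the free space and agree on its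
  basis.
\<close>

lemma tensor_linear_ext:
  assumes f: "linear_map K (tensor_space K V W) P f" and g: "linear_map K (tensor_space K V W) P g"
    and eq: "\<And>v w. \<lbrakk>v \<in> carrier V; w \<in> carrier W\<rbrakk>
      \<Longrightarrow> f (pure_tensor K V W v w) = g (pure_tensor K V W v w)"
    and t: "t \<in> carrier (tensor_space K V W)"
  shows "f t = g t"
proof -
  interpret V: vectorspace K V by (rule V)
  let ?k = "\<lambda>x. tensor_kernel K V W +>\<^bsub>F\<^esub> x"
  obtain x where x: "x \<in> carrier F" "t = ?k x"
    using t by (auto simp: tensor_space_def A_RCOSETS_def')
  have "f (?k x) = g (?k x)"
  proof (rule V.free_linear_ext[where f = "\<lambda>x. f (?k x)" and g = "\<lambda>x. g (?k x)"])
    show "linear_map K F P (\<lambda>x. f (?k x))" "linear_map K F P (\<lambda>x. g (?k x))"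
      by (rule linear_map_compose[OF tensor_coset_linear f] linear_map_compose[OF tensor_coset_linear g])+
  qed (use x eq in \<open>auto simp: pure_tensor_def\<close>)
  with x show ?thesis by simp
qed

context
  fixes P :: "('k, 'p, 'q) module_scheme" and f
  assumes P: "vectorspace K P" and f: "bilinear_map K V W P f"
begin

text \<open>
  The linear extension of a bilinear map vanishes on the relators, and its kernel is a subspace, so it
  vanishes on their span.
\<close>

lemma tensor_kernel_lift_zero:
  assumes "x \<in> tensor_kernel K V W"
  shows "free_lift K P (\<lambda>i. f (fst i) (snd i)) x = \<zero>\<^bsub>P\<^esub>"
proof -
  interpret V: vectorspace K V by (rule V)
  interpret W: vectorspace K W by (rule W)
  interpret P: vectorspace K P by (rule P)
  interpret F: vectorspace K F by (rule free_pairs_vectorspace)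
  let ?L = "free_lift K P (\<lambda>i. f (fst i) (snd i))" and ?d = "\<lambda>v w. free_basis K (v, w)"
  have fcl: "f v w \<in> carrier P" if "v \<in> carrier V" "w \<in> carrier W" for v w
    using that by (rule linear_map_closed[OF bilinear_map_right[OF f]])
  interpret L: linear_map K F P ?L
    by (rule P.free_lift_linear) (auto intro: fcl)
  have Ld: "?L (?d v w) = f v w" if "v \<in> carrier V" "w \<in> carrier W" for v w
    using P.free_lift_basis[of "\<lambda>i. f (fst i) (snd i)" "(v, w)"] fcl that by simp
  note fadd = linear_map_add[OF bilinear_map_right[OF f]] linear_map_add[OF bilinear_map_left[OF f]]
  note fsmult = linear_map_smult[OF bilinear_map_right[OF f]] linear_map_smult[OF bilinear_map_left[OF f]]
  note cl = free_pairs_basis F.a_closed F.smult_closed V.a_closed W.a_closed V.smult_closed W.smult_closed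
  have "tensor_relators K V W \<subseteq> L.ker"
  proof
    fix r assume r: "r \<in> tensor_relators K V W"
    have "?L r = \<zero>\<^bsub>P\<^esub>"
      using r unfolding tensor_relators_def Let_def
      by (elim UnE CollectE exE conjE)
        (simp_all add: L.T_minus L.T_add L.T_smult Ld cl fcl fadd fsmult P.r_neg P.minus_eq
          del: free_space_simps)
    with r tensor_relators_subset show "r \<in> L.ker" by (auto simp: L.ker_def)
  qed
  then have "tensor_kernel K V W \<subseteq> L.ker"
    unfolding tensor_kernel_def by (rule F.span_is_subset[OF _ L.ker_is_submodule])
  with assms show ?thesis by (auto simp: L.ker_def)
qed

text \<open>
  Whichever representative is chosen, it differs from \<open>x\<close> by an element of the tensor kernel.
\<close>

lemma tensor_lift_coset:
  assumes x: "x \<in> carrier F"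
  shows "tensor_lift K P f (tensor_kernel K V W +>\<^bsub>F\<^esub> x) = free_lift K P (\<lambda>i. f (fst i) (snd i)) x"
proof -
  interpret P: vectorspace K P by (rule P)
  interpret F: vectorspace K F by (rule free_pairs_vectorspace)
  interpret A: abelian_subgroup "tensor_kernel K V W" F
    by (rule submodule_abelian_subgroup[OF tensor_kernel_submodule])
  let ?L = "free_lift K P (\<lambda>i. f (fst i) (snd i))"
  have fcl: "f v w \<in> carrier P" if "v \<in> carrier V" "w \<in> carrier W" for v w
    using that by (rule linear_map_closed[OF bilinear_map_right[OF f]])
  interpret L: linear_map K F P ?L
    by (rule P.free_lift_linear) (auto intro: fcl)
  define y where "y = (SOME y. y \<in> tensor_kernel K V W +>\<^bsub>F\<^esub> x)"
  have "y \<in> tensor_kernel K V W +>\<^bsub>F\<^esub> x"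
    unfolding y_def by (rule someI[where x = x]) (rule A.a_rcos_self[OF x])
  then obtain h where h: "h \<in> tensor_kernel K V W" "y = h \<oplus>\<^bsub>F\<^esub> x"
    by (auto simp: a_r_coset_def')
  have "?L y = ?L x"
    using h x tensor_kernel_lift_zero[OF h(1)] A.a_Hcarr[OF h(1)]
    by (simp add: L.T_add del: free_space_simps)
  then show ?thesis by (simp add: tensor_lift_def Let_def y_def free_lift_def)
qed

lemma tensor_lift_linear: "linear_map K (tensor_space K V W) P (tensor_lift K P f)"
proof (rule linear_mapI[OF tensor_space_vectorspace P])
  interpret P: vectorspace K P by (rule P)
  interpret F: vectorspace K F by (rule free_pairs_vectorspace)
  let ?L = "free_lift K P (\<lambda>i. f (fst i) (snd i))" and ?k = "\<lambda>x. tensor_kernel K V W +>\<^bsub>F\<^esub> x"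
  let ?T = "tensor_space K V W"
  have L: "linear_map K F P ?L"
    by (rule P.free_lift_linear) (auto intro: linear_map_closed[OF bilinear_map_right[OF f]])
  note k = tensor_coset_linear
  have coset: "\<exists>x\<in>carrier F. t = ?k x" if "t \<in> carrier ?T" for t
    using that by (auto simp: tensor_space_def A_RCOSETS_def')
  show "tensor_lift K P f t \<in> carrier P" if "t \<in> carrier ?T" for t
    using coset[OF that] by (auto simp: tensor_lift_coset linear_map_closed[OF L])
  show "tensor_lift K P f (s \<oplus>\<^bsub>?T\<^esub> t) = tensor_lift K P f s \<oplus>\<^bsub>P\<^esub> tensor_lift K P f t"
    if st: "s \<in> carrier ?T" "t \<in> carrier ?T" for s t
  proof -
    obtain x y where xy: "x \<in> carrier F" "y \<in> carrier F" "s = ?k x" "t = ?k y"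
      using coset st by metis
    have "s \<oplus>\<^bsub>?T\<^esub> t = ?k (x \<oplus>\<^bsub>F\<^esub> y)"
      unfolding xy using xy by (intro linear_map_add[OF k, symmetric])
    then show ?thesis
      using xy tensor_lift_coset[OF F.a_closed[OF xy(1,2)]] linear_map_add[OF L xy(1,2)]
      by (simp add: tensor_lift_coset del: free_space_simps)
  qed
  show "tensor_lift K P f (c \<odot>\<^bsub>?T\<^esub> t) = c \<odot>\<^bsub>P\<^esub> tensor_lift K P f t"
    if ct: "c \<in> carrier K" "t \<in> carrier ?T" for c t
  proof -
    obtain x where x: "x \<in> carrier F" "t = ?k x" using coset ct by metis
    have "c \<odot>\<^bsub>?T\<^esub> t = ?k (c \<odot>\<^bsub>F\<^esub> x)"
      unfolding x using x ct by (intro linear_map_smult[OF k, symmetric])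
    then show ?thesis
      using x tensor_lift_coset[OF F.smult_closed[OF ct(1) x(1)]] linear_map_smult[OF L ct(1) x(1)]
      by (simp add: tensor_lift_coset del: free_space_simps)
  qed
qed

lemma tensor_lift_pure:
  assumes v: "v \<in> carrier V" and w: "w \<in> carrier W"
  shows "tensor_lift K P f (pure_tensor K V W v w) = f v w"
proof -
  interpret P: vectorspace K P by (rule P)
  have "f v w \<in> carrier P" using v w by (rule linear_map_closed[OF bilinear_map_right[OF f]])
  then show ?thesis
    unfolding pure_tensor_def
    using P.free_lift_basis[of "\<lambda>i. f (fst i) (snd i)" "(v, w)"]
    by (simp add: tensor_lift_coset free_pairs_basis v w)
qed

end

end

section \<open>Tensor products of maps and associativity\<close>

lemma bilinear_map_precompose:
  assumes h: "bilinear_map K V' W' P h" and f: "linear_map K V V' f" and g: "linear_map K W W' g"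
  shows "bilinear_map K V W P (\<lambda>v w. h (f v) (g w))"
proof (rule bilinear_mapI)
  show "linear_map K W P (\<lambda>w. h (f v) (g w))" if "v \<in> carrier V" for v
    by (rule linear_map_compose[OF g bilinear_map_right[OF h linear_map_closed[OF f that]]])
  show "linear_map K V P (\<lambda>v. h (f v) (g w))" if "w \<in> carrier W" for w
    by (rule linear_map_compose[OF f bilinear_map_left[OF h linear_map_closed[OF g that]]])
qed

context
  fixes K :: "('k, 'r) ring_scheme"
    and V :: "('k, 'v, 's) module_scheme" and V' :: "('k, 'v2, 's2) module_scheme"
    and W :: "('k, 'w, 't) module_scheme" and W' :: "('k, 'w2, 't2) module_scheme" and f g
  assumes f: "linear_map K V V' f" and g: "linear_map K W W' g"
begin

private lemma tensor_map_bilinear: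
  "bilinear_map K V W (tensor_space K V' W') (\<lambda>v w. pure_tensor K V' W' (f v) (g w))"
  by (rule bilinear_map_precompose[OF pure_tensor_bilinear[OF linear_map_codomain[OF f] linear_map_codomain[OF g]] f g])

lemma tensor_map_linear:
  "linear_map K (tensor_space K V W) (tensor_space K V' W') (tensor_map K V' W' f g)"
  unfolding tensor_map_def
  using f g
  by (intro tensor_lift_linear tensor_map_bilinear tensor_space_vectorspace)
    (auto dest: linear_map_domain linear_map_codomain)

lemma tensor_map_pure:
  "\<lbrakk>v \<in> carrier V; w \<in> carrier W\<rbrakk>
    \<Longrightarrow> tensor_map K V' W' f g (pure_tensor K V W v w) = pure_tensor K V' W' (f v) (g w)"
  unfolding tensor_map_def
  using f g
  by (intro tensor_lift_pure tensor_map_bilinear tensor_space_vectorspace)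
    (auto dest: linear_map_domain linear_map_codomain)

end

text \<open>
  The associativity maps are lifts whose integrand is itself a lift, depending on the remaining factor.
  Linearity in that factor holds because the lifts of \<open>f (u + u')\<close> and of \<open>f u\<close> plus \<open>f u'\<close> are linear
  maps that agree on pure tensors.
\<close>

lemma tensor_lift_parameter_linear:
  assumes V: "vectorspace K V" and W: "vectorspace K W" and U: "vectorspace K U" and P: "vectorspace K P"
    and f: "\<And>u. u \<in> carrier U \<Longrightarrow> bilinear_map K V W P (f u)"
    and fu: "\<And>v w. \<lbrakk>v \<in> carrier V; w \<in> carrier W\<rbrakk> \<Longrightarrow> linear_map K U P (\<lambda>u. f u v w)"
    and t: "t \<in> carrier (tensor_space K V W)"
  shows "linear_map K U P (\<lambda>u. tensor_lift K P (f u) t)"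
proof (rule linear_mapI[OF U P])
  interpret U: vectorspace K U by (rule U)
  note lin = tensor_lift_linear[OF V W P f] and pure = tensor_lift_pure[OF V W P f]
  show "tensor_lift K P (f u) t \<in> carrier P" if "u \<in> carrier U" for u
    by (rule linear_map_closed[OF lin[OF that] t])
  show "tensor_lift K P (f (u \<oplus>\<^bsub>U\<^esub> u')) t = tensor_lift K P (f u) t \<oplus>\<^bsub>P\<^esub> tensor_lift K P (f u') t"
    if u: "u \<in> carrier U" "u' \<in> carrier U" for u u'
    by (rule tensor_linear_ext[OF V W lin[OF U.a_closed[OF u]]
          linear_map_sum[OF lin[OF u(1)] lin[OF u(2)]] _ t])
      (simp add: u pure linear_map_add[OF fu])
  show "tensor_lift K P (f (c \<odot>\<^bsub>U\<^esub> u)) t = c \<odot>\<^bsub>P\<^esub> tensor_lift K P (f u) t"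
    if c: "c \<in> carrier K" and u: "u \<in> carrier U" for c u
    by (rule tensor_linear_ext[OF V W lin[OF U.smult_closed[OF c u]]
          linear_map_scale[OF lin[OF u] c] _ t])
      (simp add: c u pure linear_map_smult[OF fu])
qed

context
  fixes K :: "('k, 'r) ring_scheme" and U :: "('k, 'u, 's) module_scheme"
    and V :: "('k, 'v, 't) module_scheme" and W :: "('k, 'w, 'q) module_scheme"
  assumes U: "vectorspace K U" and V: "vectorspace K V" and W: "vectorspace K W"
begin

private abbreviation (input) "UV \<equiv> tensor_space K U V"
private abbreviation (input) "VW \<equiv> tensor_space K V W"
private abbreviation (input) "R3 \<equiv> tensor_space K U VW"
private abbreviation (input) "L3 \<equiv> tensor_space K UV W"

private lemmas spaces = U V W tensor_space_vectorspace[OF U V] tensor_space_vectorspace[OF V W]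
  tensor_space_vectorspace[OF U tensor_space_vectorspace[OF V W]]
  tensor_space_vectorspace[OF tensor_space_vectorspace[OF U V] W]

private lemmas UV_pure = pure_tensor_bilinear[OF U V]
private lemmas VW_pure = pure_tensor_bilinear[OF V W]
private lemmas R3_pure = pure_tensor_bilinear[OF U tensor_space_vectorspace[OF V W]]
private lemmas L3_pure = pure_tensor_bilinear[OF tensor_space_vectorspace[OF U V] W]

lemma pure_tensor_right_linear_ext:
  assumes f: "linear_map K R3 P f" and g: "linear_map K R3 P g"
    and eq: "\<And>u v w. \<lbrakk>u \<in> carrier U; v \<in> carrier V; w \<in> carrier W\<rbrakk>
      \<Longrightarrow> f (pure_tensor K U VW u (pure_tensor K V W v w)) = g (pure_tensor K U VW u (pure_tensor K V W v w))"
    and t: "t \<in> carrier R3"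
  shows "f t = g t"
proof (rule tensor_linear_ext[OF U spaces(5) f g _ t])
  fix u s assume u: "u \<in> carrier U" and s: "s \<in> carrier VW"
  note lin = linear_map_compose[OF bilinear_map_right[OF R3_pure u]]
  show "f (pure_tensor K U VW u s) = g (pure_tensor K U VW u s)"
    by (rule tensor_linear_ext[OF V W lin[OF f] lin[OF g] eq[OF u] s])
qed

private lemma assoc_inner:
  assumes w: "w \<in> carrier W"
  shows "bilinear_map K U V R3 (\<lambda>u v. pure_tensor K U VW u (pure_tensor K V W v w))"
  using bilinear_map_precompose[OF R3_pure linear_map_ident[OF U] bilinear_map_left[OF VW_pure w]] .

private lemma assoc_outer:
  "bilinear_map K UV W R3
     (\<lambda>t w. tensor_lift K R3 (\<lambda>u v. pure_tensor K U VW u (pure_tensor K V W v w)) t)"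
proof (rule bilinear_mapI)
  fix t assume t: "t \<in> carrier UV"
  show "linear_map K W R3
      (\<lambda>w. tensor_lift K R3 (\<lambda>u v. pure_tensor K U VW u (pure_tensor K V W v w)) t)"
    by (rule tensor_lift_parameter_linear[OF U V W spaces(6) assoc_inner _ t])
      (auto intro: linear_map_compose[OF bilinear_map_right[OF VW_pure] bilinear_map_right[OF R3_pure]])
next
  fix w assume w: "w \<in> carrier W"
  show "linear_map K UV R3 (tensor_lift K R3 (\<lambda>u v. pure_tensor K U VW u (pure_tensor K V W v w)))"
    by (rule tensor_lift_linear[OF U V spaces(6) assoc_inner[OF w]])
qed

lemma tensor_assoc_linear: "linear_map K L3 R3 (tensor_assoc K U V W)"
  unfolding tensor_assoc_def Let_def by (rule tensor_lift_linear[OF spaces(4) W spaces(6) assoc_outer])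

lemma tensor_assoc_pure:
  assumes u: "u \<in> carrier U" and v: "v \<in> carrier V" and w: "w \<in> carrier W"
  shows "tensor_assoc K U V W (pure_tensor K UV W (pure_tensor K U V u v) w)
    = pure_tensor K U VW u (pure_tensor K V W v w)"
proof -
  have "pure_tensor K U V u v \<in> carrier UV"
    by (rule linear_map_closed[OF bilinear_map_right[OF UV_pure u] v])
  then show ?thesis
    unfolding tensor_assoc_def Let_def
    by (simp add: tensor_lift_pure[OF spaces(4) W spaces(6) assoc_outer]
        tensor_lift_pure[OF U V spaces(6) assoc_inner] u v w)
qed

private lemma assoc_inv_inner:
  assumes u: "u \<in> carrier U"
  shows "bilinear_map K V W L3 (\<lambda>v w. pure_tensor K UV W (pure_tensor K U V u v) w)"
  using bilinear_map_precompose[OF L3_pure bilinear_map_right[OF UV_pure u] linear_map_ident[OF W]] .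

private lemma assoc_inv_outer:
  "bilinear_map K U VW L3
     (\<lambda>u t. tensor_lift K L3 (\<lambda>v w. pure_tensor K UV W (pure_tensor K U V u v) w) t)"
proof (rule bilinear_mapI)
  fix t assume t: "t \<in> carrier VW"
  show "linear_map K U L3
      (\<lambda>u. tensor_lift K L3 (\<lambda>v w. pure_tensor K UV W (pure_tensor K U V u v) w) t)"
    by (rule tensor_lift_parameter_linear[OF V W U spaces(7) assoc_inv_inner _ t])
      (auto intro: linear_map_compose[OF bilinear_map_left[OF UV_pure] bilinear_map_left[OF L3_pure]])
next
  fix u assume u: "u \<in> carrier U"
  show "linear_map K VW L3 (tensor_lift K L3 (\<lambda>v w. pure_tensor K UV W (pure_tensor K U V u v) w))"
    by (rule tensor_lift_linear[OF V W spaces(7) assoc_inv_inner[OF u]])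
qed

lemma tensor_assoc_inv_linear: "linear_map K R3 L3 (tensor_assoc_inv K U V W)"
  unfolding tensor_assoc_inv_def Let_def
  by (rule tensor_lift_linear[OF U spaces(5) spaces(7) assoc_inv_outer])

lemma tensor_assoc_inv_pure:
  assumes u: "u \<in> carrier U" and v: "v \<in> carrier V" and w: "w \<in> carrier W"
  shows "tensor_assoc_inv K U V W (pure_tensor K U VW u (pure_tensor K V W v w))
    = pure_tensor K UV W (pure_tensor K U V u v) w"
proof -
  have "pure_tensor K V W v w \<in> carrier VW"
    by (rule linear_map_closed[OF bilinear_map_right[OF VW_pure v] w])
  then show ?thesis
    unfolding tensor_assoc_inv_def Let_def
    by (simp add: tensor_lift_pure[OF U spaces(5) spaces(7) assoc_inv_outer]
        tensor_lift_pure[OF V W spaces(7) assoc_inv_inner] u v w)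
qed

end

section \<open>Two identities between linear combinations\<close>

context vectorspace
begin

text \<open>
  The form taken by a composite of two operators of the shape of \<open>B\<close> when \<open>\<alpha>\<close> is involutive:
  the hypotheses say that \<open>x\<close> and \<open>y\<close> occur with coefficient 0 and \<open>z\<close> with coefficient 1.
\<close>

lemma inverse_cancellation:
  assumes cde: "c \<in> carrier K" "d \<in> carrier K" "e \<in> carrier K"
    and cde': "c' \<in> carrier K" "d' \<in> carrier K" "e' \<in> carrier K"
    and xyz: "x \<in> carrier V" "y \<in> carrier V" "z \<in> carrier V"
    and cancel: "c \<otimes>\<^bsub>K\<^esub> (c' \<oplus>\<^bsub>K\<^esub> e') \<oplus>\<^bsub>K\<^esub> d \<otimes>\<^bsub>K\<^esub> c' \<oplus>\<^bsub>K\<^esub> e \<otimes>\<^bsub>K\<^esub> c' = \<zero>\<^bsub>K\<^esub>"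
      "c \<otimes>\<^bsub>K\<^esub> d' \<oplus>\<^bsub>K\<^esub> d \<otimes>\<^bsub>K\<^esub> (d' \<oplus>\<^bsub>K\<^esub> e') \<oplus>\<^bsub>K\<^esub> e \<otimes>\<^bsub>K\<^esub> d' = \<zero>\<^bsub>K\<^esub>"
      "e \<otimes>\<^bsub>K\<^esub> e' = \<one>\<^bsub>K\<^esub>"
  shows "lincomb3 V c d e (lincomb3 V c' d' e' x y x) (lincomb3 V c' d' e' x y y) (lincomb3 V c' d' e' x y z) = z"
proof -
  have "lincomb3 V c d e (lincomb3 V c' d' e' x y x) (lincomb3 V c' d' e' x y y) (lincomb3 V c' d' e' x y z)
    = (c \<otimes>\<^bsub>K\<^esub> (c' \<oplus>\<^bsub>K\<^esub> e') \<oplus>\<^bsub>K\<^esub> d \<otimes>\<^bsub>K\<^esub> c' \<oplus>\<^bsub>K\<^esub> e \<otimes>\<^bsub>K\<^esub> c') \<odot>\<^bsub>V\<^esub> x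
      \<oplus>\<^bsub>V\<^esub> (c \<otimes>\<^bsub>K\<^esub> d' \<oplus>\<^bsub>K\<^esub> d \<otimes>\<^bsub>K\<^esub> (d' \<oplus>\<^bsub>K\<^esub> e') \<oplus>\<^bsub>K\<^esub> e \<otimes>\<^bsub>K\<^esub> d') \<odot>\<^bsub>V\<^esub> y
      \<oplus>\<^bsub>V\<^esub> (e \<otimes>\<^bsub>K\<^esub> e') \<odot>\<^bsub>V\<^esub> z"
    using cde cde' xyz
    by (simp add: lincomb3_def smult_l_distr smult_r_distr smult_assoc1 a_ac)
  then show ?thesis using cancel xyz by simp
qed

text \<open>
  The two sides of the braid relation on \<open>a \<otimes> b \<otimes> c\<close>.  With \<open>P = \<alpha>\<^sup>2(a)(b'c')\<close>, the vectors stand for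
  \<open>p = P \<otimes> 1 \<otimes> 1\<close>, \<open>q = 1 \<otimes> P \<otimes> 1\<close>, \<open>r = 1 \<otimes> 1 \<otimes> P\<close>;
  \<open>a1\<close>, \<open>a2\<close>, \<open>a3\<close> are the tensors with factors \<open>\<alpha>\<^sup>3(a)\<close>, \<open>\<alpha>\<^sup>2(bc)\<close> in this order and a unit in the third,
  second and first place; \<open>b1\<close>, \<open>b2\<close>, \<open>b3\<close> are the same with \<open>\<alpha>\<^sup>2(ab)\<close>, \<open>\<alpha>\<^sup>3(c)\<close>; and
  \<open>t = \<alpha>\<^sup>3(a) \<otimes> \<alpha>\<^sup>3(b) \<otimes> \<alpha>\<^sup>3(c)\<close>.

  By linearity it suffices to treat ten free generators, where the identity can be compared
  coefficient by coefficient; for example \<open>q\<close> has coefficient \<open>l n (l - n)\<close> on both sides.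
\<close>

lemma braid_combination:
  fixes l n :: 'a
  assumes ln: "l \<in> carrier K" "n \<in> carrier K"
    and cl: "p \<in> carrier V" "q \<in> carrier V" "r \<in> carrier V"
      "a1 \<in> carrier V" "a2 \<in> carrier V" "a3 \<in> carrier V"
      "b1 \<in> carrier V" "b2 \<in> carrier V" "b3 \<in> carrier V" "t \<in> carrier V"
  defines "C \<equiv> lincomb3 V l n (\<ominus>\<^bsub>K\<^esub> n)"
  shows
    "C (C (C p p p) (C q r q) (C a1 a2 a1))
       (C (C a1 a2 a2) (C q r a3) (C a1 a2 a2))
       (C (C b1 b2 b2) (C q r b3) (C a1 a2 t))
   = C (C (C p q b1) (C b2 b3 b2) (C b2 b3 b2))
       (C (C p q q) (C r r r) (C b2 b3 b3))
       (C (C p q a1) (C a2 a3 a2) (C b2 b3 t))"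
proof -
  define vs where "vs = [p, q, r, a1, a2, a3, b1, b2, b3, t]"
  let ?F = "free_space K {..<10::nat}" and ?E = "free_lift K V ((!) vs)"
  let ?e = "free_basis K :: nat \<Rightarrow> nat \<Rightarrow> 'a" and ?C = "lincomb3 ?F l n (\<ominus>\<^bsub>K\<^esub> n)"
  interpret F: vectorspace K ?F by (rule free_space_vectorspace)
  have m: "\<ominus>\<^bsub>K\<^esub> n \<in> carrier K" using ln by simp
  have vs: "vs ! i \<in> carrier V" if "i < 10" for i
    using that cl by (auto simp: vs_def less_Suc_eq numeral_eq_Suc)
  have E: "linear_map K ?F V ?E" by (rule free_lift_linear) (use vs in auto)
  have Ee: "?E (?e i) = vs ! i" if "i < 10" for i using vs[OF that] by (rule free_lift_basis)
  have e: "?e i \<in> carrier ?F" if "i < 10" for i using that by (intro free_basis_closed) simp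
  have EC: "?E (?C x y z) = C (?E x) (?E y) (?E z)"
    if "x \<in> carrier ?F" "y \<in> carrier ?F" "z \<in> carrier ?F" for x y z
    unfolding C_def by (rule linear_map_lincomb3[OF E ln m that])
  note cls = F.lincomb3_closed[OF ln m] e
  let ?p = "?e 0" and ?q = "?e 1" and ?r = "?e 2" and ?a1 = "?e 3" and ?a2 = "?e 4" and ?a3 = "?e 5"
    and ?b1 = "?e 6" and ?b2 = "?e 7" and ?b3 = "?e 8" and ?t = "?e 9"
  have "?C (?C (?C ?p ?p ?p) (?C ?q ?r ?q) (?C ?a1 ?a2 ?a1))
       (?C (?C ?a1 ?a2 ?a2) (?C ?q ?r ?a3) (?C ?a1 ?a2 ?a2))
       (?C (?C ?b1 ?b2 ?b2) (?C ?q ?r ?b3) (?C ?a1 ?a2 ?t))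
   = ?C (?C (?C ?p ?q ?b1) (?C ?b2 ?b3 ?b2) (?C ?b2 ?b3 ?b2))
       (?C (?C ?p ?q ?q) (?C ?r ?r ?r) (?C ?b2 ?b3 ?b3))
       (?C (?C ?p ?q ?a1) (?C ?a2 ?a3 ?a2) (?C ?b2 ?b3 ?t))" (is "?L = ?R")
  proof
    fix i :: nat
    \<comment> \<open>Beyond the ten generators all coordinates are zero.\<close>
    consider "i = 0" | "i = 1" | "i = 2" | "i = 3" | "i = 4" | "i = 5" | "i = 6" | "i = 7"
      | "i = 8" | "i = 9" | "i \<ge> 10" by (cases "i < 10") (auto simp: numeral_eq_Suc less_Suc_eq)
    then show "?L i = ?R i"
      by cases (use ln in \<open>simp_all add: lincomb3_def free_basis_def l_minus r_minus, algebra+\<close>)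
  qed
  from arg_cong[OF this, of ?E] show ?thesis
    by (simp add: EC cls Ee del: free_space_simps) (simp add: vs_def)
qed

end

section \<open>The twisted operator of a Hom-algebra\<close>

context hom_algebra
begin

abbreviation "prd \<equiv> hom_prod K A \<mu>"
abbreviation "T \<equiv> tensor_space K A A"
abbreviation "tens \<equiv> pure_tensor K A A"
abbreviation "T3 \<equiv> tensor_space K A T"
abbreviation "tens3 x y z \<equiv> pure_tensor K A T x (tens y z)"

lemma A_vectorspace: "vectorspace K A"
  by unfold_locales

lemmas T_vectorspace = tensor_space_vectorspace[OF A_vectorspace A_vectorspace]
lemmas T3_vectorspace = tensor_space_vectorspace[OF A_vectorspace T_vectorspace]
lemmas tens_bilinear = pure_tensor_bilinear[OF A_vectorspace A_vectorspace]
lemmas outer_tens_bilinear = pure_tensor_bilinear[OF A_vectorspace T_vectorspace]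

lemma tens_closed: "\<lbrakk>a \<in> carrier A; b \<in> carrier A\<rbrakk> \<Longrightarrow> tens a b \<in> carrier T"
  by (rule linear_map_closed[OF bilinear_map_right[OF tens_bilinear]])

lemma tens3_closed: "\<lbrakk>a \<in> carrier A; b \<in> carrier A; c \<in> carrier A\<rbrakk> \<Longrightarrow> tens3 a b c \<in> carrier T3"
  by (intro linear_map_closed[OF bilinear_map_right[OF outer_tens_bilinear]] tens_closed)

lemma prd_bilinear: "bilinear_map K A A A prd"
  unfolding hom_prod_def
  by (intro bilinear_mapI linear_map_compose[OF bilinear_map_right[OF tens_bilinear] linear_mult]
      linear_map_compose[OF bilinear_map_left[OF tens_bilinear] linear_mult])

lemma prd_closed: "\<lbrakk>a \<in> carrier A; b \<in> carrier A\<rbrakk> \<Longrightarrow> prd a b \<in> carrier A"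
  by (rule linear_map_closed[OF bilinear_map_right[OF prd_bilinear]])

lemmas twist_closed = linear_map_closed[OF linear_twist]

text \<open>
  Besides linearity only the values on pure tensors are prescribed, so the predicate applies to the lift of any
  map that agrees with the three-term expression on the carrier of \<open>A\<close>.
\<close>

definition twisted_operator ::
  "'k \<Rightarrow> 'k \<Rightarrow> 'k \<Rightarrow> (('a \<times> 'a \<Rightarrow> 'k) set \<Rightarrow> ('a \<times> 'a \<Rightarrow> 'k) set) \<Rightarrow> bool" where
  "twisted_operator c d e B \<longleftrightarrow> linear_map K T T B
    \<and> (\<forall>a\<in>carrier A. \<forall>b\<in>carrier A. B (tens a b)
        = lincomb3 T c d e (tens (prd a b) u) (tens u (prd a b)) (tens (\<alpha> a) (\<alpha> b)))"

lemma
  assumes cde: "c \<in> carrier K" "d \<in> carrier K" "e \<in> carrier K"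
    and f: "\<And>a b. \<lbrakk>a \<in> carrier A; b \<in> carrier A\<rbrakk>
      \<Longrightarrow> f a b = lincomb3 T c d e (tens (prd a b) u) (tens u (prd a b)) (tens (\<alpha> a) (\<alpha> b))"
  shows tensor_lift_twisted_operator: "twisted_operator c d e (tensor_lift K T f)"
    and tensor_lift_tens:
      "\<lbrakk>a \<in> carrier A; b \<in> carrier A\<rbrakk> \<Longrightarrow> tensor_lift K T f (tens a b) = f a b"
proof -
  have bil: "bilinear_map K A A T f"
  proof (rule bilinear_mapI)
    fix a assume a: "a \<in> carrier A"
    note prd_a = linear_map_compose[OF bilinear_map_right[OF prd_bilinear a]]
    have "linear_map K A T
        (\<lambda>b. lincomb3 T c d e (tens (prd a b) u) (tens u (prd a b)) (tens (\<alpha> a) (\<alpha> b)))"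
      using a cde
      by (intro linear_map_combination prd_a bilinear_map_left[OF tens_bilinear unit_closed]
          bilinear_map_right[OF tens_bilinear unit_closed]
          linear_map_compose[OF linear_twist bilinear_map_right[OF tens_bilinear]] twist_closed)
    then show "linear_map K A T (f a)" by (rule linear_map_cong) (simp add: f a)
  next
    fix b assume b: "b \<in> carrier A"
    note prd_b = linear_map_compose[OF bilinear_map_left[OF prd_bilinear b]]
    have "linear_map K A T
        (\<lambda>a. lincomb3 T c d e (tens (prd a b) u) (tens u (prd a b)) (tens (\<alpha> a) (\<alpha> b)))"
      using b cde
      by (intro linear_map_combination prd_b bilinear_map_left[OF tens_bilinear unit_closed]
          bilinear_map_right[OF tens_bilinear unit_closed]
          linear_map_compose[OF linear_twist bilinear_map_left[OF tens_bilinear]] twist_closed)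
    then show "linear_map K A T (\<lambda>a. f a b)" by (rule linear_map_cong) (simp add: f b)
  qed
  note lift = tensor_lift_linear[OF A_vectorspace A_vectorspace T_vectorspace bil]
    tensor_lift_pure[OF A_vectorspace A_vectorspace T_vectorspace bil]
  show "\<lbrakk>a \<in> carrier A; b \<in> carrier A\<rbrakk> \<Longrightarrow> tensor_lift K T f (tens a b) = f a b"
    by (rule lift)
  show "twisted_operator c d e (tensor_lift K T f)"
    by (simp add: twisted_operator_def lift f)
qed

lemma
  assumes "twisted_operator c d e B"
  shows twisted_operator_linear: "linear_map K T T B"
    and twisted_operator_tens:
      "\<lbrakk>a \<in> carrier A; b \<in> carrier A\<rbrakk> \<Longrightarrow> B (tens a b)
        = lincomb3 T c d e (tens (prd a b) u) (tens u (prd a b)) (tens (\<alpha> a) (\<alpha> b))"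
  using assms by (simp_all add: twisted_operator_def)

context
  fixes c d e B
  assumes cde: "c \<in> carrier K" "d \<in> carrier K" "e \<in> carrier K"
    and B: "twisted_operator c d e B"
begin

private lemmas B_linear = twisted_operator_linear[OF B]
private lemmas B_tens = twisted_operator_tens[OF B]

text \<open>
  On \<open>a \<otimes> b\<close> both sides are the combination of \<open>a'b' \<otimes> 1\<close>, \<open>1 \<otimes> a'b'\<close> and \<open>\<alpha>\<^sup>2(a) \<otimes> \<alpha>\<^sup>2(b)\<close>.
\<close>

lemma twisted_operator_commutes:
  assumes t: "t \<in> carrier T"
  shows "tensor_map K A A \<alpha> \<alpha> (B t) = B (tensor_map K A A \<alpha> \<alpha> t)"
proof (rule tensor_linear_ext[OF A_vectorspace A_vectorspace _ _ _ t])
  note \<alpha>\<alpha> = tensor_map_linear[OF linear_twist linear_twist]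
  show "linear_map K T T (\<lambda>t. tensor_map K A A \<alpha> \<alpha> (B t))"
    by (rule linear_map_compose[OF B_linear \<alpha>\<alpha>])
  show "linear_map K T T (\<lambda>t. B (tensor_map K A A \<alpha> \<alpha> t))"
    by (rule linear_map_compose[OF \<alpha>\<alpha> B_linear])
  show "tensor_map K A A \<alpha> \<alpha> (B (tens a b))
      = B (tensor_map K A A \<alpha> \<alpha> (tens a b))"
    if "a \<in> carrier A" "b \<in> carrier A" for a b
    using that cde
    by (simp add: B_tens linear_map_lincomb3[OF \<alpha>\<alpha>] tensor_map_pure[OF linear_twist linear_twist]
        tens_closed prd_closed twist_closed unit_closed twist_mult twist_unit)
qed

lemma twist_tensor_op_linear: "linear_map K T3 T3 (twist_tensor_op K A \<alpha> B)"
  unfolding twist_tensor_op_def by (rule tensor_map_linear[OF linear_twist B_linear])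

text \<open>
  The two operators of the braid relation map pure threefold tensors to combinations of such
  tensors, so their iterates can be computed by rewriting.
\<close>

lemma twist_tensor_op_tens3:
  assumes xyz: "x \<in> carrier A" "y \<in> carrier A" "z \<in> carrier A"
  shows "twist_tensor_op K A \<alpha> B (tens3 x y z)
    = lincomb3 T3 c d e (tens3 (\<alpha> x) (prd y z) u) (tens3 (\<alpha> x) u (prd y z)) (tens3 (\<alpha> x) (\<alpha> y) (\<alpha> z))"
  using xyz cde
  by (simp add: twist_tensor_op_def tensor_map_pure[OF linear_twist B_linear] B_tens
      linear_map_lincomb3[OF bilinear_map_right[OF outer_tens_bilinear]]
      tens_closed prd_closed twist_closed unit_closed)

lemma op_tensor_twist_linear: "linear_map K T3 T3 (op_tensor_twist K A B \<alpha>)"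
  unfolding op_tensor_twist_def comp_def
  by (intro linear_map_compose[OF linear_map_compose[OF tensor_assoc_inv_linear
        tensor_map_linear[OF B_linear linear_twist]] tensor_assoc_linear] A_vectorspace)

lemma op_tensor_twist_tens3:
  assumes xyz: "x \<in> carrier A" "y \<in> carrier A" "z \<in> carrier A"
  shows "op_tensor_twist K A B \<alpha> (tens3 x y z)
    = lincomb3 T3 c d e (tens3 (prd x y) u (\<alpha> z)) (tens3 u (prd x y) (\<alpha> z)) (tens3 (\<alpha> x) (\<alpha> y) (\<alpha> z))"
proof -
  note AAA = A_vectorspace A_vectorspace A_vectorspace
  note left = pure_tensor_bilinear[OF T_vectorspace A_vectorspace]
  show ?thesis
    using xyz cde
    by (simp add: op_tensor_twist_def tensor_assoc_inv_pure[OF AAA]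
        tensor_map_pure[OF B_linear linear_twist] B_tens
        linear_map_lincomb3[OF bilinear_map_left[OF left]] linear_map_lincomb3[OF tensor_assoc_linear[OF AAA]]
        linear_map_closed[OF bilinear_map_left[OF left]] tensor_assoc_pure[OF AAA]
        tens_closed prd_closed twist_closed unit_closed)
qed

end

text \<open>
  Expanding both sides gives the two nested combinations of ten tensors compared in
  \<open>braid_combination\<close>, which agree because the third coefficient is minus the second.
\<close>

lemma twisted_operator_braid:
  assumes ln: "l \<in> carrier K" "n \<in> carrier K"
    and B: "twisted_operator l n (\<ominus>\<^bsub>K\<^esub> n) B" and t: "t \<in> carrier T3"
  defines "X \<equiv> twist_tensor_op K A \<alpha> B"
    and "Y \<equiv> op_tensor_twist K A B \<alpha>"
  shows "X (Y (X t)) = Y (X (Y t))"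
proof (rule pure_tensor_right_linear_ext[OF A_vectorspace A_vectorspace A_vectorspace _ _ _ t])
  have m: "\<ominus>\<^bsub>K\<^esub> n \<in> carrier K" using ln by simp
  note lnm = ln m
  have X: "linear_map K T3 T3 X" unfolding X_def by (rule twist_tensor_op_linear[OF lnm B])
  have Y: "linear_map K T3 T3 Y" unfolding Y_def by (rule op_tensor_twist_linear[OF lnm B])
  show "linear_map K T3 T3 (\<lambda>t. X (Y (X t)))"
    by (rule linear_map_compose[OF X linear_map_compose[OF Y X]])
  show "linear_map K T3 T3 (\<lambda>t. Y (X (Y t)))"
    by (rule linear_map_compose[OF Y linear_map_compose[OF X Y]])
  interpret T3: vectorspace K T3 by (rule T3_vectorspace)
  let ?C = "lincomb3 T3 l n (\<ominus>\<^bsub>K\<^esub> n)"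
  have Xt: "X (tens3 x y z) = ?C (tens3 (\<alpha> x) (prd y z) u) (tens3 (\<alpha> x) u (prd y z)) (tens3 (\<alpha> x) (\<alpha> y) (\<alpha> z))"
    if "x \<in> carrier A" "y \<in> carrier A" "z \<in> carrier A" for x y z
    unfolding X_def using that by (rule twist_tensor_op_tens3[OF lnm B])
  have Yt: "Y (tens3 x y z) = ?C (tens3 (prd x y) u (\<alpha> z)) (tens3 u (prd x y) (\<alpha> z)) (tens3 (\<alpha> x) (\<alpha> y) (\<alpha> z))"
    if "x \<in> carrier A" "y \<in> carrier A" "z \<in> carrier A" for x y z
    unfolding Y_def using that by (rule op_tensor_twist_tens3[OF lnm B])
  note cl = tens3_closed prd_closed twist_closed unit_closed
  fix a b c assume abc: "a \<in> carrier A" "b \<in> carrier A" "c \<in> carrier A"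
  note comb = linear_map_lincomb3[OF X lnm] linear_map_lincomb3[OF Y lnm] T3.lincomb3_closed[OF lnm]
  have assoc: "prd (prd x y) (\<alpha> z) = prd (\<alpha> x) (prd y z)"
    if "x \<in> carrier A" "y \<in> carrier A" "z \<in> carrier A" for x y z
    using that by (simp add: hom_assoc)
  note rules = Xt Yt comb cl abc twist_unit mult_unit unit_mult twist_mult assoc
  show "X (Y (X (tens3 a b c))) = Y (X (Y (tens3 a b c)))"
    \<comment> \<open>The rewriting pushes \<open>\<alpha>\<close> inside products and brackets to the right, which identifies
      the tensors that hom-associativity makes equal.\<close>
    by (simp add: rules) (rule T3.braid_combination; simp add: rules ln)
qed

text \<open>
  The tensors \<open>ab \<otimes> 1\<close>, \<open>1 \<otimes> ab\<close> and \<open>a' \<otimes> b'\<close> all have product \<open>(ab)'\<close>, so \<open>B'\<close> maps each of them to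
  a combination of \<open>(ab)' \<otimes> 1\<close>, \<open>1 \<otimes> (ab)'\<close> and its own twist, and the twist of the third is
  \<open>a \<otimes> b\<close>.
\<close>

lemma twisted_operators_inverse:
  assumes cde: "c \<in> carrier K" "d \<in> carrier K" "e \<in> carrier K" and B: "twisted_operator c d e B"
    and cde': "c' \<in> carrier K" "d' \<in> carrier K" "e' \<in> carrier K" and B': "twisted_operator c' d' e' B'"
    and involutive: "\<And>a. a \<in> carrier A \<Longrightarrow> \<alpha> (\<alpha> a) = a"
    and cancel: "c \<otimes>\<^bsub>K\<^esub> (c' \<oplus>\<^bsub>K\<^esub> e') \<oplus>\<^bsub>K\<^esub> d \<otimes>\<^bsub>K\<^esub> c' \<oplus>\<^bsub>K\<^esub> e \<otimes>\<^bsub>K\<^esub> c' = \<zero>\<^bsub>K\<^esub>"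
      "c \<otimes>\<^bsub>K\<^esub> d' \<oplus>\<^bsub>K\<^esub> d \<otimes>\<^bsub>K\<^esub> (d' \<oplus>\<^bsub>K\<^esub> e') \<oplus>\<^bsub>K\<^esub> e \<otimes>\<^bsub>K\<^esub> d' = \<zero>\<^bsub>K\<^esub>"
      "e \<otimes>\<^bsub>K\<^esub> e' = \<one>\<^bsub>K\<^esub>"
    and t: "t \<in> carrier T"
  shows "B' (B t) = t"
proof (rule tensor_linear_ext[OF A_vectorspace A_vectorspace _ _ _ t])
  note lin = twisted_operator_linear[OF B] twisted_operator_linear[OF B']
  show "linear_map K T T (\<lambda>t. B' (B t))" by (rule linear_map_compose[OF lin])
  show "linear_map K T T (\<lambda>t. t)" by (rule linear_map_ident[OF T_vectorspace])
  interpret T: vectorspace K T by (rule T_vectorspace)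
  fix a b assume ab: "a \<in> carrier A" "b \<in> carrier A"
  note cl = ab prd_closed twist_closed unit_closed tens_closed
  have "B' (B (tens a b)) = lincomb3 T c d e (B' (tens (prd a b) u)) (B' (tens u (prd a b))) (B' (tens (\<alpha> a) (\<alpha> b)))"
    by (simp add: twisted_operator_tens[OF B] linear_map_lincomb3[OF lin(2) cde] cl)
  also have "\<dots> = lincomb3 T c d e
      (lincomb3 T c' d' e' (tens (\<alpha> (prd a b)) u) (tens u (\<alpha> (prd a b))) (tens (\<alpha> (prd a b)) u))
      (lincomb3 T c' d' e' (tens (\<alpha> (prd a b)) u) (tens u (\<alpha> (prd a b))) (tens u (\<alpha> (prd a b))))
      (lincomb3 T c' d' e' (tens (\<alpha> (prd a b)) u) (tens u (\<alpha> (prd a b))) (tens a b))"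
    by (simp add: twisted_operator_tens[OF B'] cl mult_unit unit_mult twist_mult twist_unit involutive)
  also have "\<dots> = tens a b"
    by (rule T.inverse_cancellation[OF cde cde' _ _ _ cancel]) (simp_all add: cl)
  finally show "B' (B (tens a b)) = tens a b" .
qed

end

theorem theorem2p4:
  fixes K :: "('k, 'r) ring_scheme" and A :: "('k, 'a, 's) module_scheme"
    and \<mu> :: "('a \<times> 'a \<Rightarrow> 'k) set \<Rightarrow> 'a" and u :: 'a and \<alpha> :: "'a \<Rightarrow> 'a"
    and l n :: 'k
    and T :: "('k, ('a \<times> 'a \<Rightarrow> 'k) set) module"
    and tens :: "'a \<Rightarrow> 'a \<Rightarrow> ('a \<times> 'a \<Rightarrow> 'k) set"
    and prd :: "'a \<Rightarrow> 'a \<Rightarrow> 'a"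
    and f g :: "'a \<Rightarrow> 'a \<Rightarrow> ('a \<times> 'a \<Rightarrow> 'k) set"
    and B B' :: "('a \<times> 'a \<Rightarrow> 'k) set \<Rightarrow> ('a \<times> 'a \<Rightarrow> 'k) set"
  assumes hom_algebra: "hom_algebra K A \<mu> u \<alpha>"
    and scalars: "l \<in> carrier K" "n \<in> carrier K"
    and T_def: "T = tensor_space K A A"
    and tens_def: "tens = pure_tensor K A A"
    and prd_def: "prd = hom_prod K A \<mu>"
    and f_def: "f = (\<lambda>a b. l \<odot>\<^bsub>T\<^esub> tens (prd a b) u \<oplus>\<^bsub>T\<^esub> n \<odot>\<^bsub>T\<^esub> tens u (prd a b)
                        \<ominus>\<^bsub>T\<^esub> n \<odot>\<^bsub>T\<^esub> tens (\<alpha> a) (\<alpha> b))"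
    and g_def: "g = (\<lambda>a b. inv\<^bsub>K\<^esub> n \<odot>\<^bsub>T\<^esub> tens (prd a b) u \<oplus>\<^bsub>T\<^esub> inv\<^bsub>K\<^esub> l \<odot>\<^bsub>T\<^esub> tens u (prd a b)
                        \<ominus>\<^bsub>T\<^esub> inv\<^bsub>K\<^esub> n \<odot>\<^bsub>T\<^esub> tens (\<alpha> a) (\<alpha> b))"
    and B_def: "B = tensor_lift K T f"
    and B'_def: "B' = tensor_lift K T g"
  shows "linear_map K T T B
    \<and> (\<forall>a \<in> carrier A. \<forall>b \<in> carrier A. B (tens a b) = f a b)
    \<and> HYBE_solution K A \<alpha> B
    \<and> (l \<noteq> \<zero>\<^bsub>K\<^esub> \<and> n \<noteq> \<zero>\<^bsub>K\<^esub> \<and> (\<forall>a \<in> carrier A. \<alpha> (\<alpha> a) = a) \<longrightarrow>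
           linear_map K T T B'
         \<and> (\<forall>a \<in> carrier A. \<forall>b \<in> carrier A. B' (tens a b) = g a b)
         \<and> (\<forall>t \<in> carrier T. B' (B t) = t \<and> B (B' t) = t))"
proof -
  interpret H: hom_algebra K A \<mu> u \<alpha> by (rule hom_algebra)
  interpret T: vectorspace K T unfolding T_def by (rule H.T_vectorspace)
  note defs = T_def tens_def prd_def
  note cl = H.prd_closed[folded defs] H.tens_closed[folded defs] H.unit_closed H.twist_closed
  \<comment> \<open>Only on the carrier is subtracting \<open>e z\<close> the same as adding \<open>(- e) z\<close>; hence \<open>f\<close> and \<open>g\<close> have the
    three-term shape only for arguments in \<open>A\<close>.\<close>
  have difference: "c \<odot>\<^bsub>T\<^esub> x \<oplus>\<^bsub>T\<^esub> d \<odot>\<^bsub>T\<^esub> y \<ominus>\<^bsub>T\<^esub> e \<odot>\<^bsub>T\<^esub> z = lincomb3 T c d (\<ominus>\<^bsub>K\<^esub> e) x y z"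
    if "e \<in> carrier K" "z \<in> carrier T" for c d e x y z
    using that by (simp add: lincomb3_def a_minus_def T.smult_l_minus)
  have m: "\<ominus>\<^bsub>K\<^esub> n \<in> carrier K" using scalars by simp
  have f: "f a b = lincomb3 T l n (\<ominus>\<^bsub>K\<^esub> n) (tens (prd a b) u) (tens u (prd a b)) (tens (\<alpha> a) (\<alpha> b))"
    if "a \<in> carrier A" "b \<in> carrier A" for a b
    using that scalars by (simp add: f_def difference cl)
  note B = H.tensor_lift_twisted_operator[OF scalars m, folded defs, of f, OF f, folded B_def]
  note B_lin = H.twisted_operator_linear[OF B, folded defs]
  have B_val: "B (tens a b) = f a b" if "a \<in> carrier A" "b \<in> carrier A" for a b
    unfolding B_def using that by (intro H.tensor_lift_tens[OF scalars m, folded defs] f)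
  have hybe: "HYBE_solution K A \<alpha> B"
    unfolding HYBE_solution_def comp_def
    using B_lin[unfolded T_def] H.linear_twist H.twisted_operator_commutes[OF scalars m B]
      H.twisted_operator_braid[OF scalars B]
    by simp
  have inverse: "linear_map K T T B'
      \<and> (\<forall>a \<in> carrier A. \<forall>b \<in> carrier A. B' (tens a b) = g a b)
      \<and> (\<forall>t \<in> carrier T. B' (B t) = t \<and> B (B' t) = t)"
    if nz: "l \<noteq> \<zero>\<^bsub>K\<^esub>" "n \<noteq> \<zero>\<^bsub>K\<^esub>" and involutive: "\<And>a. a \<in> carrier A \<Longrightarrow> \<alpha> (\<alpha> a) = a"
  proof -
    let ?l = "inv\<^bsub>K\<^esub> l" and ?n = "inv\<^bsub>K\<^esub> n"
    have units: "l \<in> Units K" "n \<in> Units K" using scalars nz by (auto simp: H.field_Units)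
    have inv: "?l \<in> carrier K" "?n \<in> carrier K" using units by auto
    have m': "\<ominus>\<^bsub>K\<^esub> ?n \<in> carrier K" using inv by simp
    have ll: "l \<otimes>\<^bsub>K\<^esub> ?l = \<one>\<^bsub>K\<^esub>" and nn: "n \<otimes>\<^bsub>K\<^esub> ?n = \<one>\<^bsub>K\<^esub>" using units by simp_all
    have g: "g a b = lincomb3 T ?n ?l (\<ominus>\<^bsub>K\<^esub> ?n) (tens (prd a b) u) (tens u (prd a b)) (tens (\<alpha> a) (\<alpha> b))"
      if "a \<in> carrier A" "b \<in> carrier A" for a b
      using that inv by (simp add: g_def difference cl)
    note B' = H.tensor_lift_twisted_operator[OF inv(2,1) m', folded defs, of g, OF g, folded B'_def]
    note B'_lin = H.twisted_operator_linear[OF B', folded defs]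
    have B'_val: "B' (tens a b) = g a b" if "a \<in> carrier A" "b \<in> carrier A" for a b
      unfolding B'_def using that by (intro H.tensor_lift_tens[OF inv(2,1) m', folded defs] g)
    note K = scalars inv
    have zero: "\<one>\<^bsub>K\<^esub> \<ominus>\<^bsub>K\<^esub> \<one>\<^bsub>K\<^esub> = \<zero>\<^bsub>K\<^esub>" by algebra
    have left: "B' (B t) = t" if t: "t \<in> carrier T" for t
    proof (rule H.twisted_operators_inverse[OF scalars m B inv(2,1) m' B' involutive])
      have "l \<otimes>\<^bsub>K\<^esub> (?n \<oplus>\<^bsub>K\<^esub> \<ominus>\<^bsub>K\<^esub> ?n) \<oplus>\<^bsub>K\<^esub> n \<otimes>\<^bsub>K\<^esub> ?n \<oplus>\<^bsub>K\<^esub> \<ominus>\<^bsub>K\<^esub> n \<otimes>\<^bsub>K\<^esub> ?n = n \<otimes>\<^bsub>K\<^esub> ?n \<ominus>\<^bsub>K\<^esub> n \<otimes>\<^bsub>K\<^esub> ?n"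
        using K by algebra
      then show "l \<otimes>\<^bsub>K\<^esub> (?n \<oplus>\<^bsub>K\<^esub> \<ominus>\<^bsub>K\<^esub> ?n) \<oplus>\<^bsub>K\<^esub> n \<otimes>\<^bsub>K\<^esub> ?n \<oplus>\<^bsub>K\<^esub> \<ominus>\<^bsub>K\<^esub> n \<otimes>\<^bsub>K\<^esub> ?n = \<zero>\<^bsub>K\<^esub>"
        by (simp only: nn zero)
      have "l \<otimes>\<^bsub>K\<^esub> ?l \<oplus>\<^bsub>K\<^esub> n \<otimes>\<^bsub>K\<^esub> (?l \<oplus>\<^bsub>K\<^esub> \<ominus>\<^bsub>K\<^esub> ?n) \<oplus>\<^bsub>K\<^esub> \<ominus>\<^bsub>K\<^esub> n \<otimes>\<^bsub>K\<^esub> ?l = l \<otimes>\<^bsub>K\<^esub> ?l \<ominus>\<^bsub>K\<^esub> n \<otimes>\<^bsub>K\<^esub> ?n"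
        using K by algebra
      then show "l \<otimes>\<^bsub>K\<^esub> ?l \<oplus>\<^bsub>K\<^esub> n \<otimes>\<^bsub>K\<^esub> (?l \<oplus>\<^bsub>K\<^esub> \<ominus>\<^bsub>K\<^esub> ?n) \<oplus>\<^bsub>K\<^esub> \<ominus>\<^bsub>K\<^esub> n \<otimes>\<^bsub>K\<^esub> ?l = \<zero>\<^bsub>K\<^esub>"
        by (simp only: ll nn zero)
      have "\<ominus>\<^bsub>K\<^esub> n \<otimes>\<^bsub>K\<^esub> \<ominus>\<^bsub>K\<^esub> ?n = n \<otimes>\<^bsub>K\<^esub> ?n" using K by algebra
      then show "\<ominus>\<^bsub>K\<^esub> n \<otimes>\<^bsub>K\<^esub> \<ominus>\<^bsub>K\<^esub> ?n = \<one>\<^bsub>K\<^esub>" by (simp only: nn zero)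
    qed (assumption | rule t[unfolded T_def])+
    have right: "B (B' t) = t" if t: "t \<in> carrier T" for t
    proof (rule H.twisted_operators_inverse[OF inv(2,1) m' B' scalars m B involutive])
      have "?n \<otimes>\<^bsub>K\<^esub> (l \<oplus>\<^bsub>K\<^esub> \<ominus>\<^bsub>K\<^esub> n) \<oplus>\<^bsub>K\<^esub> ?l \<otimes>\<^bsub>K\<^esub> l \<oplus>\<^bsub>K\<^esub> \<ominus>\<^bsub>K\<^esub> ?n \<otimes>\<^bsub>K\<^esub> l = l \<otimes>\<^bsub>K\<^esub> ?l \<ominus>\<^bsub>K\<^esub> n \<otimes>\<^bsub>K\<^esub> ?n"
        using K by algebra
      then show "?n \<otimes>\<^bsub>K\<^esub> (l \<oplus>\<^bsub>K\<^esub> \<ominus>\<^bsub>K\<^esub> n) \<oplus>\<^bsub>K\<^esub> ?l \<otimes>\<^bsub>K\<^esub> l \<oplus>\<^bsub>K\<^esub> \<ominus>\<^bsub>K\<^esub> ?n \<otimes>\<^bsub>K\<^esub> l = \<zero>\<^bsub>K\<^esub>"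
        by (simp only: ll nn zero)
      have "?n \<otimes>\<^bsub>K\<^esub> n \<oplus>\<^bsub>K\<^esub> ?l \<otimes>\<^bsub>K\<^esub> (n \<oplus>\<^bsub>K\<^esub> \<ominus>\<^bsub>K\<^esub> n) \<oplus>\<^bsub>K\<^esub> \<ominus>\<^bsub>K\<^esub> ?n \<otimes>\<^bsub>K\<^esub> n = n \<otimes>\<^bsub>K\<^esub> ?n \<ominus>\<^bsub>K\<^esub> n \<otimes>\<^bsub>K\<^esub> ?n"
        using K by algebra
      then show "?n \<otimes>\<^bsub>K\<^esub> n \<oplus>\<^bsub>K\<^esub> ?l \<otimes>\<^bsub>K\<^esub> (n \<oplus>\<^bsub>K\<^esub> \<ominus>\<^bsub>K\<^esub> n) \<oplus>\<^bsub>K\<^esub> \<ominus>\<^bsub>K\<^esub> ?n \<otimes>\<^bsub>K\<^esub> n = \<zero>\<^bsub>K\<^esub>"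
        by (simp only: nn zero)
      have "\<ominus>\<^bsub>K\<^esub> ?n \<otimes>\<^bsub>K\<^esub> \<ominus>\<^bsub>K\<^esub> n = n \<otimes>\<^bsub>K\<^esub> ?n" using K by algebra
      then show "\<ominus>\<^bsub>K\<^esub> ?n \<otimes>\<^bsub>K\<^esub> \<ominus>\<^bsub>K\<^esub> n = \<one>\<^bsub>K\<^esub>" by (simp only: nn zero)
    qed (assumption | rule t[unfolded T_def])+
    show ?thesis by (intro conjI ballI B'_lin B'_val left right)
  qed
  show ?thesis by (intro conjI ballI impI B_lin B_val hybe inverse) simp_all
qed

end
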